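(* Let $\mathbb F_\infty$ be the free group on infinitely many generators $\{g_i\}_{i\in\mathbb Z}$, and let $\alpha$ be the automorphism of the reduced group $C^*$-algebra $C^*_r(\mathbb F_\infty)$ induced by the free shift $\beta:g_i\mapsto g_{i+1}$, $i\in\mathbb Z$, on the generators. Then $\alpha$ is $E$-mixing with $E=\tau(\,\cdot\,)1$, where $\tau$ is the canonical trace on $C^*_r(\mathbb F_\infty)$; that is, for every $x\in C^*_r(\mathbb F_\infty)$ and every state $\varphi$ of $C^*_r(\mathbb F_\infty)$, $$\lim_{n\to+\infty}\varphi(\alpha^n(x))=\tau(x).$$
   Context: $C^*_r(\mathbb F_\infty)$ is the $C^*$-algebra generated by the left regular representation $\lambda$ of $\mathbb F_\infty$ on $\ell^2(\mathbb F_\infty)$. The automorphism $\alpha$ is determined by $\alpha(\lambda_g)=\lambda_{\beta(g)}$, where $\beta$ is the group automorphism extending $g_i\mapsto g_{i+1}$. The canonical trace is $\tau(x)=\langle x\delta_e,\delta_e\rangle$. A pair $(\mathfrak A,\alpha)$ of a unital $C^*$-algebra and an automorphism is called $E$-mixing, for a linear map $E:\mathfrak A\to\mathfrak A$, if $\lim_{n\to+\infty}\varphi(\alpha^n(x))=\varphi(E(x))$ for all $x\in\mathfrak A$ and all states $\varphi$ of $\mathfrak A$. *)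

theory Defs
  imports "HOL-Analysis.Analysis" "HOL-Algebra.Group"
begin

section \<open>The Hilbert space of square-summable functions\<close>

typedef 'a ell2 = "{f :: 'a \<Rightarrow> complex. (\<lambda>h. (cmod (f h))\<^sup>2) summable_on UNIV}"
  morphisms ell2_apply Abs_ell2
  by (rule exI[of _ "\<lambda>_. 0"]) simp

lemma ell2_eqI: "(\<And>h. ell2_apply x h = ell2_apply y h) \<Longrightarrow> x = y"
  by (metis ell2_apply_inject ext)

lemma ell2_summable: "(\<lambda>h. (cmod (ell2_apply x h))\<^sup>2) summable_on UNIV"
  using ell2_apply[of x] by simp

lemma ell2_apply_Abs:
  "(\<lambda>h. (cmod (f h))\<^sup>2) summable_on UNIV \<Longrightarrow> ell2_apply (Abs_ell2 f) = f"
  by (simp add: Abs_ell2_inverse)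

lemma ell2_memI:
  assumes "\<And>F. finite F \<Longrightarrow> (\<Sum>h\<in>F. (cmod (f h))\<^sup>2) \<le> C"
  shows "(\<lambda>h. (cmod (f h))\<^sup>2) summable_on UNIV"
  by (rule nonneg_bdd_above_summable_on) (auto intro!: bdd_aboveI[where M=C] assms)

lemma ell2_summable_add:
  assumes "(\<lambda>h. (cmod (f h))\<^sup>2) summable_on UNIV" "(\<lambda>h. (cmod (g h))\<^sup>2) summable_on UNIV"
  shows "(\<lambda>h. (cmod (f h + g h))\<^sup>2) summable_on UNIV"
proof (rule summable_on_comparison_test)
  show "(\<lambda>h. 2 * (cmod (f h))\<^sup>2 + 2 * (cmod (g h))\<^sup>2) summable_on UNIV"
    by (intro summable_on_add summable_on_cmult_right assms)
  fix h
  have "(cmod (f h + g h))\<^sup>2 \<le> (cmod (f h) + cmod (g h))\<^sup>2"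
    by (intro power_mono norm_triangle_ineq) simp
  also have "\<dots> \<le> 2 * (cmod (f h))\<^sup>2 + 2 * (cmod (g h))\<^sup>2"
    using sum_squares_bound[of "cmod (f h)" "cmod (g h)"] by (simp add: power2_sum)
  finally show "(cmod (f h + g h))\<^sup>2 \<le> 2 * (cmod (f h))\<^sup>2 + 2 * (cmod (g h))\<^sup>2" .
qed simp

lemma ell2_summable_scale:
  assumes "(\<lambda>h. (cmod (f h))\<^sup>2) summable_on UNIV"
  shows "(\<lambda>h. (cmod (c * f h))\<^sup>2) summable_on UNIV"
  using summable_on_cmult_right[OF assms, of "(cmod c)\<^sup>2"]
  by (simp add: norm_mult power_mult_distrib)

lemma ell2_mult_summable:
  "(\<lambda>h. ell2_apply x h * cnj (ell2_apply y h)) summable_on UNIV"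
proof (rule abs_summable_summable, rule summable_on_comparison_test)
  show "(\<lambda>h. (cmod (ell2_apply x h))\<^sup>2 + (cmod (ell2_apply y h))\<^sup>2) summable_on UNIV"
    by (intro summable_on_add ell2_summable)
  fix h
  have "2 * cmod (ell2_apply x h) * cmod (ell2_apply y h)
          \<le> (cmod (ell2_apply x h))\<^sup>2 + (cmod (ell2_apply y h))\<^sup>2"
    by (rule sum_squares_bound)
  moreover have "0 \<le> cmod (ell2_apply x h) * cmod (ell2_apply y h)" by simp
  ultimately show "norm (ell2_apply x h * cnj (ell2_apply y h))
          \<le> (cmod (ell2_apply x h))\<^sup>2 + (cmod (ell2_apply y h))\<^sup>2"
    unfolding norm_mult complex_mod_cnj by linarith
qed simp

definition cscale :: "complex \<Rightarrow> 'a ell2 \<Rightarrow> 'a ell2" where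
  "cscale c x = Abs_ell2 (\<lambda>h. c * ell2_apply x h)"

text \<open>Linear in the first argument.\<close>

definition cinner :: "'a ell2 \<Rightarrow> 'a ell2 \<Rightarrow> complex" where
  "cinner x y = (\<Sum>\<^sub>\<infinity>h. ell2_apply x h * cnj (ell2_apply y h))"

definition ket :: "'a \<Rightarrow> 'a ell2" where
  "ket g = Abs_ell2 (\<lambda>h. if h = g then 1 else 0)"

lemma ell2_apply_cscale [simp]: "ell2_apply (cscale c x) h = c * ell2_apply x h"
  unfolding cscale_def by (subst ell2_apply_Abs) (auto intro: ell2_summable_scale ell2_summable)

lemma ell2_apply_ket: "ell2_apply (ket g) h = (if h = g then 1 else 0)"
proof -
  have "(\<lambda>h. (cmod (if h = g then 1 else 0))\<^sup>2) summable_on {g}"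
    by (rule summable_on_finite) simp
  hence "(\<lambda>h. (cmod (if h = g then 1 else 0))\<^sup>2) summable_on UNIV"
    by (rule summable_on_cong_neutral[THEN iffD1, rotated -1]) auto
  thus ?thesis unfolding ket_def by (simp add: ell2_apply_Abs)
qed

text \<open>The real inner product and the norm are those underlying \<^const>\<open>cinner\<close>.\<close>

instantiation ell2 :: (type) real_inner
begin

definition "0 = Abs_ell2 (\<lambda>_. 0)"
definition "x + y = Abs_ell2 (\<lambda>h. ell2_apply x h + ell2_apply y h)"
definition "r *\<^sub>R x = cscale (complex_of_real r) x"
definition "- x = cscale (-1) (x :: 'a ell2)"
definition "x - y = x + - (y :: 'a ell2)"
definition "inner x y = Re (cinner x y)"
definition "norm (x :: 'a ell2) = sqrt (inner x x)"
definition "dist x y = norm (x - y :: 'a ell2)"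
definition "sgn x = inverse (norm x) *\<^sub>R (x :: 'a ell2)"
definition
  "(uniformity :: ('a ell2 \<times> 'a ell2) filter) = (INF e\<in>{0<..}. principal {(x, y). dist x y < e})"
definition
  "open (S :: 'a ell2 set) = (\<forall>x\<in>S. \<forall>\<^sub>F (x', y) in uniformity. x' = x \<longrightarrow> y \<in> S)"

lemma ell2_apply_0: "ell2_apply 0 h = 0"
  unfolding zero_ell2_def by (subst ell2_apply_Abs) auto

lemma ell2_apply_plus: "ell2_apply (x + y) h = ell2_apply x h + ell2_apply y h"
  unfolding plus_ell2_def
  by (subst ell2_apply_Abs) (auto intro: ell2_summable_add ell2_summable)

lemma cinner_add_left: "cinner (x + y) z = cinner x z + cinner y z"
  unfolding cinner_def ell2_apply_plus distrib_right by (intro infsum_add ell2_mult_summable)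

lemma cinner_cscale_left: "cinner (cscale c x) z = c * cinner x z"
  unfolding cinner_def ell2_apply_cscale mult.assoc
  by (rule infsum_cmult_right) (rule ell2_mult_summable)

lemma cinner_cnj: "cinner y x = cnj (cinner x y)"
  unfolding cinner_def infsum_cnj[symmetric] by (simp add: mult.commute)

lemma cinner_self: "cinner x x = of_real (\<Sum>\<^sub>\<infinity>h. (cmod (ell2_apply x h))\<^sup>2)"
proof -
  have "((\<lambda>h. complex_of_real ((cmod (ell2_apply x h))\<^sup>2)) has_sum
          of_real (\<Sum>\<^sub>\<infinity>h. (cmod (ell2_apply x h))\<^sup>2)) UNIV"
    by (intro has_sum_of_real has_sum_infsum ell2_summable)
  thus ?thesis
    unfolding cinner_def by (simp add: infsumI flip: complex_norm_square)
qed

instance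
proof
  fix x y z :: "'a ell2" and a b :: real
  show "dist x y = norm (x - y)" by (fact dist_ell2_def)
  show "x + y + z = x + (y + z)" "x + y = y + x" "0 + x = x"
    by (auto intro!: ell2_eqI simp: ell2_apply_plus ell2_apply_0)
  show "- x + x = 0" "x - y = x + - y"
    by (auto intro!: ell2_eqI simp: ell2_apply_plus ell2_apply_0 uminus_ell2_def minus_ell2_def)
  show "a *\<^sub>R (x + y) = a *\<^sub>R x + a *\<^sub>R y" "(a + b) *\<^sub>R x = a *\<^sub>R x + b *\<^sub>R x"
    "a *\<^sub>R b *\<^sub>R x = (a * b) *\<^sub>R x" "1 *\<^sub>R x = x"
    by (auto intro!: ell2_eqI simp: ell2_apply_plus scaleR_ell2_def algebra_simps)
  show "sgn x = inverse (norm x) *\<^sub>R x" by (fact sgn_ell2_def)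
  show "uniformity = (INF e\<in>{0<..}. principal {(x, y :: 'a ell2). dist x y < e})"
    by (fact uniformity_ell2_def)
  show "inner x y = inner y x"
    unfolding inner_ell2_def by (subst cinner_cnj) simp
  show "inner (x + y) z = inner x z + inner y z"
    unfolding inner_ell2_def by (simp add: cinner_add_left)
  show "inner (a *\<^sub>R x) y = a * inner x y"
    unfolding inner_ell2_def scaleR_ell2_def by (simp add: cinner_cscale_left)
  show "0 \<le> inner x x"
    unfolding inner_ell2_def cinner_self by (simp add: infsum_nonneg)
  show "inner x x = 0 \<longleftrightarrow> x = 0"
  proof
    assume "inner x x = 0"
    hence "(\<Sum>\<^sub>\<infinity>h. (cmod (ell2_apply x h))\<^sup>2) = 0"
      unfolding inner_ell2_def cinner_self by simp
    hence "(cmod (ell2_apply x h))\<^sup>2 = 0" for h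
      using nonneg_infsum_le_0D[of "\<lambda>h. (cmod (ell2_apply x h))\<^sup>2" UNIV h]
      by (simp add: ell2_summable)
    thus "x = 0" by (intro ell2_eqI) (simp add: ell2_apply_0)
  next
    assume "x = 0"
    thus "inner x x = 0" unfolding inner_ell2_def cinner_self by (simp add: ell2_apply_0)
  qed
  show "norm x = sqrt (inner x x)" by (fact norm_ell2_def)
next
  fix S :: "'a ell2 set"
  show "open S = (\<forall>x\<in>S. \<forall>\<^sub>F (x', y) in uniformity. x' = x \<longrightarrow> y \<in> S)"
    by (fact open_ell2_def)
qed

end

lemma ell2_apply_zero [simp]: "ell2_apply 0 h = 0"
  by (rule ell2_apply_0)

lemma ell2_apply_add [simp]: "ell2_apply (x + y) h = ell2_apply x h + ell2_apply y h"
  by (rule ell2_apply_plus)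

lemma ell2_apply_uminus [simp]: "ell2_apply (- x) h = - ell2_apply x h"
  by (simp add: uminus_ell2_def)

lemma ell2_apply_diff [simp]: "ell2_apply (x - y) h = ell2_apply x h - ell2_apply y h"
  by (simp only: diff_conv_add_uminus ell2_apply_add ell2_apply_uminus)

lemma ell2_apply_scaleR [simp]: "ell2_apply (r *\<^sub>R x) h = of_real r * ell2_apply x h"
  by (simp add: scaleR_ell2_def)

lemma ell2_apply_sum: "ell2_apply (sum f F) h = (\<Sum>i\<in>F. ell2_apply (f i) h)"
  by (induction F rule: infinite_finite_induct) auto

lemma ell2_norm_sq: "(norm x)\<^sup>2 = (\<Sum>\<^sub>\<infinity>h. (cmod (ell2_apply x h))\<^sup>2)"
  unfolding norm_ell2_def inner_ell2_def cinner_self by (simp add: infsum_nonneg)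

lemma ell2_sum_le_norm:
  assumes "finite F" shows "(\<Sum>h\<in>F. (cmod (ell2_apply x h))\<^sup>2) \<le> (norm x)\<^sup>2"
  unfolding ell2_norm_sq by (rule finite_sum_le_infsum) (auto simp: ell2_summable assms)

lemma ell2_norm_le:
  assumes "0 \<le> C" and "\<And>F. finite F \<Longrightarrow> (\<Sum>h\<in>F. (cmod (ell2_apply x h))\<^sup>2) \<le> C\<^sup>2"
  shows "norm x \<le> C"
proof -
  have "(norm x)\<^sup>2 \<le> C\<^sup>2"
    unfolding ell2_norm_sq by (rule infsum_le_finite_sums) (auto simp: ell2_summable assms)
  thus ?thesis using assms(1) power2_le_imp_le by blast
qed

lemma cmod_ell2_apply_le: "cmod (ell2_apply x h) \<le> norm x"
  by (rule power2_le_imp_le) (use ell2_sum_le_norm[of "{h}" x] in simp_all)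

instance ell2 :: (type) complete_space
proof
  fix X :: "nat \<Rightarrow> 'a ell2"
  assume X: "Cauchy X"
  have ptw: "Cauchy (\<lambda>n. ell2_apply (X n) h)" for h
  proof (rule CauchyI)
    fix e :: real assume "0 < e"
    then obtain M where "\<And>m n. m \<ge> M \<Longrightarrow> n \<ge> M \<Longrightarrow> norm (X m - X n) < e"
      using X CauchyD by blast
    moreover have "cmod (ell2_apply (X m) h - ell2_apply (X n) h) \<le> norm (X m - X n)" for m n
      using cmod_ell2_apply_le[of "X m - X n" h] by simp
    ultimately show "\<exists>M. \<forall>m\<ge>M. \<forall>n\<ge>M. norm (ell2_apply (X m) h - ell2_apply (X n) h) < e"
      by (meson order_le_less_trans)
  qed
  define f where "f h = lim (\<lambda>n. ell2_apply (X n) h)" for h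
  have f: "(\<lambda>n. ell2_apply (X n) h) \<longlonglongrightarrow> f h" for h
    unfolding f_def using ptw[of h] by (simp add: Cauchy_convergent convergent_LIMSEQ_iff[symmetric])
  obtain B where B: "\<And>n. norm (X n) \<le> B"
    using Cauchy_Bseq[OF X] unfolding Bseq_def by blast
  have "(\<Sum>h\<in>F. (cmod (f h))\<^sup>2) \<le> B\<^sup>2" if "finite F" for F
  proof (rule LIMSEQ_le_const2)
    show "(\<lambda>n. \<Sum>h\<in>F. (cmod (ell2_apply (X n) h))\<^sup>2) \<longlonglongrightarrow> (\<Sum>h\<in>F. (cmod (f h))\<^sup>2)"
      by (intro tendsto_intros f)
    show "\<exists>N. \<forall>n\<ge>N. (\<Sum>h\<in>F. (cmod (ell2_apply (X n) h))\<^sup>2) \<le> B\<^sup>2"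
      using ell2_sum_le_norm[OF that] B by (meson norm_ge_zero order_trans power_mono)
  qed
  hence fsum: "(\<lambda>h. (cmod (f h))\<^sup>2) summable_on UNIV" by (rule ell2_memI)
  define y where "y = Abs_ell2 f"
  have y: "ell2_apply y = f" unfolding y_def by (rule ell2_apply_Abs[OF fsum])
  have "X \<longlonglongrightarrow> y"
  proof (rule LIMSEQ_I)
    fix e :: real assume e: "0 < e"
    then obtain M where M: "\<And>m n. m \<ge> M \<Longrightarrow> n \<ge> M \<Longrightarrow> norm (X m - X n) < e/2"
      using X CauchyD[of X "e/2"] by auto
    have "norm (X n - y) \<le> e/2" if n: "n \<ge> M" for n
    proof (rule ell2_norm_le)
      fix F :: "'a set" assume F: "finite F"
      show "(\<Sum>h\<in>F. (cmod (ell2_apply (X n - y) h))\<^sup>2) \<le> (e/2)\<^sup>2"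
      proof (rule LIMSEQ_le_const2)
        show "(\<lambda>m. \<Sum>h\<in>F. (cmod (ell2_apply (X n - X m) h))\<^sup>2)
                \<longlonglongrightarrow> (\<Sum>h\<in>F. (cmod (ell2_apply (X n - y) h))\<^sup>2)"
          unfolding ell2_apply_diff y by (intro tendsto_intros f)
        have "(\<Sum>h\<in>F. (cmod (ell2_apply (X n - X m) h))\<^sup>2) \<le> (e/2)\<^sup>2" if "m \<ge> M" for m
        proof -
          have "(\<Sum>h\<in>F. (cmod (ell2_apply (X n - X m) h))\<^sup>2) \<le> (norm (X n - X m))\<^sup>2"
            by (rule ell2_sum_le_norm[OF F])
          also have "\<dots> \<le> (e/2)\<^sup>2" using M[OF n that] by (intro power_mono) auto
          finally show ?thesis .
        qed
        thus "\<exists>N. \<forall>m\<ge>N. (\<Sum>h\<in>F. (cmod (ell2_apply (X n - X m) h))\<^sup>2) \<le> (e/2)\<^sup>2" by blast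
      qed
    qed (use e in simp)
    thus "\<exists>M. \<forall>n\<ge>M. norm (X n - y) < e" using e by (intro exI[of _ M]) fastforce
  qed
  thus "convergent X" unfolding convergent_def by blast
qed

instance ell2 :: (type) banach ..

section \<open>Bounded operators\<close>

text \<open>
  The elements of \<^typ>\<open>'a ell2 \<Rightarrow>\<^sub>L 'a ell2\<close> are the real-linear bounded operators with the
  operator norm; \<open>bounded_ops\<close> singles out the complex-linear ones.
\<close>

definition bounded_ops :: "('a ell2 \<Rightarrow>\<^sub>L 'a ell2) set" where
  "bounded_ops = {T. \<forall>c x. blinfun_apply T (cscale c x) = cscale c (blinfun_apply T x)}"

definition op_scale :: "complex \<Rightarrow> ('a ell2 \<Rightarrow>\<^sub>L 'a ell2) \<Rightarrow> ('a ell2 \<Rightarrow>\<^sub>L 'a ell2)" where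
  "op_scale c T = Blinfun (\<lambda>x. cscale c (blinfun_apply T x))"

definition adj :: "('a ell2 \<Rightarrow>\<^sub>L 'a ell2) \<Rightarrow> ('a ell2 \<Rightarrow>\<^sub>L 'a ell2)" where
  "adj T = (THE S. \<forall>x y. cinner (blinfun_apply T x) y = cinner x (blinfun_apply S y))"

lemma norm_cscale [simp]: "norm (cscale c x) = cmod c * norm x"
proof -
  have "(norm (cscale c x))\<^sup>2 = (cmod c * norm x)\<^sup>2"
    unfolding power_mult_distrib ell2_norm_sq
    by (simp add: norm_mult power_mult_distrib infsum_cmult_right')
  thus ?thesis by simp
qed

lemma bounded_linear_cscale: "bounded_linear (cscale c)"
  by (rule bounded_linear_intro[where K="cmod c"])
     (auto intro!: ell2_eqI simp: algebra_simps)

lemma cscale_add: "cscale c (x + y) = cscale c x + cscale c y"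
  by (auto intro!: ell2_eqI simp: algebra_simps)

lemma op_scale_apply [simp]:
  "blinfun_apply (op_scale c T) x = cscale c (blinfun_apply T x)"
  unfolding op_scale_def
  by (subst bounded_linear_Blinfun_apply)
     (auto intro: bounded_linear_compose[OF bounded_linear_cscale] blinfun.bounded_linear_right)

lemma cinner_cscale_right: "cinner x (cscale c y) = cnj c * cinner x y"
  by (metis cinner_cnj cinner_cscale_left complex_cnj_mult)

lemma cinner_add_right: "cinner x (y + z) = cinner x y + cinner x z"
  by (metis cinner_cnj cinner_add_left complex_cnj_add)

lemma cinner_zero_left [simp]: "cinner 0 y = 0"
  unfolding cinner_def by simp

lemma cinner_sum_left: "cinner (sum f F) y = (\<Sum>i\<in>F. cinner (f i) y)"
  by (induction F rule: infinite_finite_induct) (auto simp: cinner_add_left)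

lemma cinner_Cauchy_Schwarz: "cmod (cinner x y) \<le> norm x * norm y"
proof -
  obtain u where u: "cmod u = 1" "u * cinner x y = of_real (cmod (cinner x y))"
  proof (cases "cinner x y = 0")
    case True thus ?thesis using that[of 1] by simp
  next
    case False
    have "cnj (cinner x y) / cmod (cinner x y) * cinner x y = of_real (cmod (cinner x y))"
      using False complex_norm_square[of "cinner x y"]
      by (simp add: field_simps power2_eq_square)
    moreover have "cmod (cnj (cinner x y) / cmod (cinner x y)) = 1"
      using False by (simp add: norm_divide)
    ultimately show ?thesis using that by blast
  qed
  have "cmod (cinner x y) = inner (cscale u x) y"
    by (simp add: inner_ell2_def cinner_cscale_left u(2))
  also have "\<dots> \<le> norm (cscale u x) * norm y" by (rule norm_cauchy_schwarz)
  finally show ?thesis by (simp add: u(1))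
qed

lemma bounded_linear_cinner_left: "bounded_linear (\<lambda>x. cinner x y)"
proof (rule bounded_linear_intro[where K="norm y"])
  show "cinner (x + z) y = cinner x y + cinner z y" for x z by (rule cinner_add_left)
  show "cinner (r *\<^sub>R x) y = r *\<^sub>R cinner x y" for r x
    by (simp add: scaleR_ell2_def cinner_cscale_left scaleR_conv_of_real)
  show "norm (cinner x y) \<le> norm x * norm y" for x by (rule cinner_Cauchy_Schwarz)
qed

lemma cinner_ket_right: "cinner x (ket h) = ell2_apply x h"
proof -
  have "cinner x (ket h) = (\<Sum>\<^sub>\<infinity>k\<in>{h}. ell2_apply x k)"
    unfolding cinner_def by (rule infsum_cong_neutral) (auto simp: ell2_apply_ket)
  thus ?thesis by simp
qed

lemma cinner_eqI:
  assumes "\<And>x. cinner x y = cinner x z" shows "y = z"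
proof (rule ell2_eqI)
  fix h show "ell2_apply y h = ell2_apply z h"
    using assms[of "ket h"] cinner_ket_right cinner_cnj by metis
qed

lemma ell2_has_sum_ket: "((\<lambda>h. cscale (ell2_apply x h) (ket h)) has_sum x) UNIV"
proof -
  let ?s = "\<lambda>F. \<Sum>h\<in>F. cscale (ell2_apply x h) (ket h)"
  let ?q = "\<lambda>h. (cmod (ell2_apply x h))\<^sup>2"
  have *: "norm (?s F - x) = sqrt ((\<Sum>\<^sub>\<infinity>h. ?q h) - sum ?q F)" if "finite F" for F
  proof -
    have "ell2_apply (?s F - x) h = (if h \<in> F then 0 else - ell2_apply x h)" for h
      using that by (simp add: ell2_apply_sum ell2_apply_ket if_distrib[where f="\<lambda>u. _ * u"] cong: if_cong)
    hence "(norm (?s F - x))\<^sup>2 = (\<Sum>\<^sub>\<infinity>h\<in>UNIV - F. ?q h)"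
      unfolding ell2_norm_sq by (intro infsum_cong_neutral) auto
    also have "\<dots> = (\<Sum>\<^sub>\<infinity>h. ?q h) - sum ?q F"
      by (subst infsum_Diff) (auto simp: ell2_summable that)
    finally show ?thesis by (intro real_sqrt_unique[symmetric]) simp_all
  qed
  have "((\<lambda>F. sqrt ((\<Sum>\<^sub>\<infinity>h. ?q h) - sum ?q F)) \<longlongrightarrow> sqrt ((\<Sum>\<^sub>\<infinity>h. ?q h) - (\<Sum>\<^sub>\<infinity>h. ?q h)))
          (finite_subsets_at_top UNIV)"
    by (intro tendsto_intros) (use has_sum_infsum[OF ell2_summable[of x]] in \<open>simp add: has_sum_def\<close>)
  hence "((\<lambda>F. norm (?s F - x)) \<longlongrightarrow> 0) (finite_subsets_at_top UNIV)"
    by (rule Lim_transform_eventually[THEN tendsto_eq_rhs])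
       (auto intro!: eventually_finite_subsets_at_top_weakI simp: *)
  thus ?thesis unfolding has_sum_def by (rule LIM_zero_cancel[OF tendsto_norm_zero_cancel])
qed

lemma adjoint_exists:
  assumes T: "T \<in> bounded_ops"
  shows "\<exists>S\<in>bounded_ops. \<forall>x y. cinner (blinfun_apply T x) y = cinner x (blinfun_apply S y)"
proof -
  have Tc: "blinfun_apply T (cscale c x) = cscale c (blinfun_apply T x)" for c x
    using T unfolding bounded_ops_def by simp
  define a where "a y h = cinner y (blinfun_apply T (ket h))" for y h
  define K where "K y = norm T * norm y" for y :: "'a ell2"
  have K0: "0 \<le> K y" for y by (simp add: K_def)
  have bd: "(\<Sum>h\<in>F. (cmod (a y h))\<^sup>2) \<le> (K y)\<^sup>2" if F: "finite F" for F y
  proof -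
    define s where "s = (\<Sum>h\<in>F. (cmod (a y h))\<^sup>2)"
    define z where "z = (\<Sum>h\<in>F. cscale (a y h) (ket h))"
    have s0: "0 \<le> s" unfolding s_def by (simp add: sum_nonneg)
    have zh: "ell2_apply z h = (if h \<in> F then a y h else 0)" for h
      using F unfolding z_def
      by (simp add: ell2_apply_sum ell2_apply_ket if_distrib[where f="\<lambda>u. _ * u"] cong: if_cong)
    have "(norm z)\<^sup>2 = (\<Sum>\<^sub>\<infinity>h\<in>F. (cmod (a y h))\<^sup>2)"
      unfolding ell2_norm_sq by (intro infsum_cong_neutral) (auto simp: zh)
    hence nz: "(norm z)\<^sup>2 = s" using F by (simp add: s_def)
    have "cinner (blinfun_apply T z) y = (\<Sum>h\<in>F. a y h * cinner (blinfun_apply T (ket h)) y)"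
      unfolding z_def by (simp add: blinfun.sum_right cinner_sum_left Tc cinner_cscale_left)
    also have "\<dots> = (\<Sum>h\<in>F. of_real ((cmod (a y h))\<^sup>2))"
      by (rule sum.cong) (simp_all add: a_def complex_norm_square flip: cinner_cnj of_real_power)
    finally have "cinner (blinfun_apply T z) y = of_real s" by (simp add: s_def)
    hence "s \<le> norm (blinfun_apply T z) * norm y"
      using cinner_Cauchy_Schwarz[of "blinfun_apply T z" y] s0 by simp
    also have "\<dots> \<le> norm T * norm z * norm y"
      by (intro mult_right_mono norm_blinfun) simp
    finally have "norm z * norm z \<le> K y * norm z"
      using nz by (simp add: K_def power2_eq_square mult_ac)
    hence "norm z \<le> K y" using K0[of y] by (cases "norm z = 0") auto
    thus ?thesis using nz unfolding s_def[symmetric] by (metis norm_ge_zero power_mono)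
  qed
  define S where "S y = Abs_ell2 (a y)" for y
  have S: "ell2_apply (S y) h = a y h" for y h
    unfolding S_def by (subst ell2_apply_Abs) (auto intro: ell2_memI bd)
  have aadd: "a (x + y) h = a x h + a y h" for x y h by (simp add: a_def cinner_add_left)
  have ascale: "a (cscale c x) h = c * a x h" for c x h by (simp add: a_def cinner_cscale_left)
  have "bounded_linear S"
  proof (rule bounded_linear_intro[where K="norm T"])
    show "S (x + y) = S x + S y" for x y by (auto intro!: ell2_eqI simp: S aadd)
    show "S (r *\<^sub>R x) = r *\<^sub>R S x" for r x
      by (auto intro!: ell2_eqI simp: S scaleR_ell2_def ascale)
    show "norm (S x) \<le> norm x * norm T" for x
      using ell2_norm_le[OF K0, of "S x" x] bd[of _ x] by (simp add: S K_def mult.commute)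
  qed
  hence BS: "blinfun_apply (Blinfun S) = S" by (rule bounded_linear_Blinfun_apply)
  have "Blinfun S \<in> bounded_ops"
    unfolding bounded_ops_def by (auto intro!: ell2_eqI simp: BS S ascale)
  moreover have "cinner (blinfun_apply T x) y = cinner x (S y)" for x y
  proof -
    have "bounded_linear (\<lambda>x. cinner (blinfun_apply T x) y)"
      by (rule bounded_linear_compose[OF bounded_linear_cinner_left blinfun.bounded_linear_right])
    from has_sum_bounded_linear[OF this ell2_has_sum_ket[of x]]
    have "((\<lambda>h. ell2_apply x h * cnj (ell2_apply (S y) h)) has_sum cinner (blinfun_apply T x) y) UNIV"
      by (simp add: Tc cinner_cscale_left S a_def flip: cinner_cnj)
    thus ?thesis unfolding cinner_def[of x "S y"] by (simp add: infsumI)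
  qed
  ultimately show ?thesis using BS by (intro bexI[of _ "Blinfun S"]) simp_all
qed

lemma adj_eqI:
  assumes "\<And>x y. cinner (blinfun_apply T x) y = cinner x (blinfun_apply S y)"
  shows "adj T = S"
  unfolding adj_def
proof (rule the_equality)
  show "\<forall>x y. cinner (blinfun_apply T x) y = cinner x (blinfun_apply S y)" using assms by blast
  fix S' assume "\<forall>x y. cinner (blinfun_apply T x) y = cinner x (blinfun_apply S' y)"
  thus "S' = S" using assms by (intro blinfun_eqI cinner_eqI) metis
qed

lemma
  assumes "T \<in> bounded_ops"
  shows adj_in_bounded_ops: "adj T \<in> bounded_ops"
    and cinner_adj: "cinner (blinfun_apply T x) y = cinner x (blinfun_apply (adj T) y)"
  using adjoint_exists[OF assms] adj_eqI by metis+

lemma closed_bounded_ops: "closed (bounded_ops :: ('a ell2 \<Rightarrow>\<^sub>L 'a ell2) set)"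
proof -
  have "closed {T :: 'a ell2 \<Rightarrow>\<^sub>L 'a ell2.
          blinfun_apply T (cscale c x) = cscale c (blinfun_apply T x)}" for c x
    by (intro closed_Collect_eq continuous_intros
        bounded_linear.continuous_on[OF bounded_linear_cscale])
  thus ?thesis unfolding bounded_ops_def by (intro closed_Collect_all)
qed

section \<open>C*-algebras of operators\<close>

definition cstar_subalgebra :: "('a ell2 \<Rightarrow>\<^sub>L 'a ell2) set \<Rightarrow> bool" where
  "cstar_subalgebra A \<longleftrightarrow>
     A \<subseteq> bounded_ops \<and> closed A \<and> 0 \<in> A \<and>
     (\<forall>S\<in>A. \<forall>T\<in>A. S + T \<in> A) \<and>
     (\<forall>c. \<forall>T\<in>A. op_scale c T \<in> A) \<and>
     (\<forall>S\<in>A. \<forall>T\<in>A. S o\<^sub>L T \<in> A) \<and>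
     (\<forall>T\<in>A. adj T \<in> A)"

definition unital_cstar_algebra :: "('a ell2 \<Rightarrow>\<^sub>L 'a ell2) set \<Rightarrow> bool" where
  "unital_cstar_algebra A \<longleftrightarrow> cstar_subalgebra A \<and> id_blinfun \<in> A"

definition linear_map_on ::
  "('a ell2 \<Rightarrow>\<^sub>L 'a ell2) set \<Rightarrow> (('a ell2 \<Rightarrow>\<^sub>L 'a ell2) \<Rightarrow> ('a ell2 \<Rightarrow>\<^sub>L 'a ell2)) \<Rightarrow> bool" where
  "linear_map_on A f \<longleftrightarrow>
     (\<forall>S\<in>A. f S \<in> A) \<and>
     (\<forall>S\<in>A. \<forall>T\<in>A. f (S + T) = f S + f T) \<and>
     (\<forall>c. \<forall>T\<in>A. f (op_scale c T) = op_scale c (f T))"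

definition cstar_automorphism ::
  "('a ell2 \<Rightarrow>\<^sub>L 'a ell2) set \<Rightarrow> (('a ell2 \<Rightarrow>\<^sub>L 'a ell2) \<Rightarrow> ('a ell2 \<Rightarrow>\<^sub>L 'a ell2)) \<Rightarrow> bool" where
  "cstar_automorphism A \<alpha> \<longleftrightarrow>
     bij_betw \<alpha> A A \<and> linear_map_on A \<alpha> \<and>
     (\<forall>S\<in>A. \<forall>T\<in>A. \<alpha> (S o\<^sub>L T) = \<alpha> S o\<^sub>L \<alpha> T) \<and>
     (\<forall>T\<in>A. \<alpha> (adj T) = adj (\<alpha> T))"

text \<open>States of a unital C*-algebra: positive linear functionals normalised at the unit.\<close>

definition state_on ::
  "('a ell2 \<Rightarrow>\<^sub>L 'a ell2) set \<Rightarrow> (('a ell2 \<Rightarrow>\<^sub>L 'a ell2) \<Rightarrow> complex) \<Rightarrow> bool" where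
  "state_on A \<phi> \<longleftrightarrow>
     (\<forall>S\<in>A. \<forall>T\<in>A. \<phi> (S + T) = \<phi> S + \<phi> T) \<and>
     (\<forall>c. \<forall>T\<in>A. \<phi> (op_scale c T) = c * \<phi> T) \<and>
     (\<forall>T\<in>A. \<phi> (adj T o\<^sub>L T) \<in> \<real>\<^sub>\<ge>\<^sub>0) \<and>
     \<phi> id_blinfun = 1"

definition E_mixing ::
  "('a ell2 \<Rightarrow>\<^sub>L 'a ell2) set \<Rightarrow> (('a ell2 \<Rightarrow>\<^sub>L 'a ell2) \<Rightarrow> ('a ell2 \<Rightarrow>\<^sub>L 'a ell2))
     \<Rightarrow> (('a ell2 \<Rightarrow>\<^sub>L 'a ell2) \<Rightarrow> ('a ell2 \<Rightarrow>\<^sub>L 'a ell2)) \<Rightarrow> bool" where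
  "E_mixing A \<alpha> E \<longleftrightarrow>
     unital_cstar_algebra A \<and> cstar_automorphism A \<alpha> \<and> linear_map_on A E \<and>
     (\<forall>x\<in>A. \<forall>\<phi>. state_on A \<phi> \<longrightarrow> (\<lambda>n. \<phi> ((\<alpha> ^^ n) x)) \<longlonglongrightarrow> \<phi> (E x))"

section \<open>Reduced group C*-algebras\<close>

text \<open>
  Here \<open>G\<close> is a group whose carrier is the whole type \<open>'g\<close>, so that \<^typ>\<open>'g ell2\<close> is the
  \<open>\<ell>\<^sup>2\<close>-space of the group and \<open>left_regular G g\<close> maps \<open>ket h\<close> to \<open>ket (g h)\<close>.
\<close>

definition left_regular :: "('g, 'm) monoid_scheme \<Rightarrow> 'g \<Rightarrow> ('g ell2 \<Rightarrow>\<^sub>L 'g ell2)" where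
  "left_regular G g = Blinfun (\<lambda>\<xi>. Abs_ell2 (\<lambda>h. ell2_apply \<xi> (inv\<^bsub>G\<^esub> g \<otimes>\<^bsub>G\<^esub> h)))"

definition reduced_cstar :: "('g, 'm) monoid_scheme \<Rightarrow> ('g ell2 \<Rightarrow>\<^sub>L 'g ell2) set" where
  "reduced_cstar G = cstar_subalgebra hull (left_regular G ` carrier G)"

definition canonical_trace :: "('g, 'm) monoid_scheme \<Rightarrow> ('g ell2 \<Rightarrow>\<^sub>L 'g ell2) \<Rightarrow> complex" where
  "canonical_trace G x = cinner (blinfun_apply x (ket \<one>\<^bsub>G\<^esub>)) (ket \<one>\<^bsub>G\<^esub>)"

section \<open>Free groups\<close>

text \<open>
  Elements are reduced words in the letters \<open>(a, True)\<close>, standing for the generator \<open>a\<close>, and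
  \<open>(a, False)\<close>, standing for its inverse.
\<close>

definition flip :: "'a \<times> bool \<Rightarrow> 'a \<times> bool" where
  "flip l = (fst l, \<not> snd l)"

definition reduced_word :: "('a \<times> bool) list \<Rightarrow> bool" where
  "reduced_word w \<longleftrightarrow> successively (\<lambda>l m. m \<noteq> flip l) w"

typedef 'a free_word = "{w :: ('a \<times> bool) list. reduced_word w}"
  morphisms letters Abs_free_word
  by (rule exI[of _ "[]"]) (simp add: reduced_word_def)

fun red_cons :: "'a \<times> bool \<Rightarrow> ('a \<times> bool) list \<Rightarrow> ('a \<times> bool) list" where
  "red_cons l [] = [l]"
| "red_cons l (m # w) = (if m = flip l then w else l # m # w)"

definition free_group :: "'a free_word monoid" where
  "free_group = \<lparr>carrier = UNIV,
     mult = (\<lambda>u v. Abs_free_word (foldr red_cons (letters u) (letters v))),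
     one = Abs_free_word []\<rparr>"

definition gen :: "'a \<Rightarrow> 'a free_word" where
  "gen a = Abs_free_word [(a, True)]"

lemma flip_flip [simp]: "flip (flip l) = l" and flip_neq [simp]: "flip l \<noteq> l" "l \<noteq> flip l"
  by (auto simp: flip_def prod_eq_iff)

lemma reduced_Cons: "reduced_word (l # w) \<longleftrightarrow> reduced_word w \<and> (w = [] \<or> hd w \<noteq> flip l)"
  by (cases w) (auto simp: reduced_word_def)

lemma reduced_red_cons: "reduced_word w \<Longrightarrow> reduced_word (red_cons l w)"
  by (cases w) (auto simp: reduced_Cons reduced_word_def[of "[]"])

lemma reduced_foldr: "reduced_word w \<Longrightarrow> reduced_word (foldr red_cons u w)"
  by (induction u) (auto intro: reduced_red_cons)

lemma red_cons_flip: "reduced_word w \<Longrightarrow> red_cons l (red_cons (flip l) w) = w"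
  by (cases w; cases "tl w") (auto simp: reduced_Cons)

lemma red_cons_reduced: "reduced_word (l # w) \<Longrightarrow> red_cons l w = l # w"
  by (cases w) (auto simp: reduced_Cons)

lemma foldr_red_cons:
  "reduced_word w \<Longrightarrow> foldr red_cons (red_cons l x) w = red_cons l (foldr red_cons x w)"
  by (cases x) (auto simp: red_cons_flip reduced_foldr)

lemma foldr_assoc:
  "reduced_word w \<Longrightarrow> foldr red_cons (foldr red_cons u v) w = foldr red_cons u (foldr red_cons v w)"
  by (induction u) (auto simp: foldr_red_cons)

lemma foldr_Nil: "reduced_word w \<Longrightarrow> foldr red_cons w [] = w"
  by (induction w) (auto simp: red_cons_reduced reduced_Cons)

lemma foldr_inverse: "foldr red_cons (rev (map flip w)) w = []"
  by (induction w) auto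

lemma reduced_inverse: "reduced_word w \<Longrightarrow> reduced_word (rev (map flip w))"
  unfolding reduced_word_def successively_rev successively_map
  by (erule successively_mono) auto

lemma reduced_letters [simp]: "reduced_word (letters u)"
  using letters[of u] by simp

lemma letters_Abs: "reduced_word w \<Longrightarrow> letters (Abs_free_word w) = w"
  by (simp add: Abs_free_word_inverse)

lemma letters_mult: "letters (u \<otimes>\<^bsub>free_group\<^esub> v) = foldr red_cons (letters u) (letters v)"
  by (simp add: free_group_def letters_Abs reduced_foldr)

lemma letters_one: "letters \<one>\<^bsub>free_group\<^esub> = []"
  by (simp add: free_group_def letters_Abs reduced_word_def)

lemma letters_gen: "letters (gen a) = [(a, True)]"
  by (simp add: gen_def letters_Abs reduced_word_def)

lemma carrier_free_group [simp]: "carrier free_group = UNIV"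
  by (simp add: free_group_def)

lemma group_free_group: "group (free_group :: 'a free_word monoid)"
proof (rule groupI)
  fix x y z :: "'a free_word"
  show "x \<otimes>\<^bsub>free_group\<^esub> y \<otimes>\<^bsub>free_group\<^esub> z = x \<otimes>\<^bsub>free_group\<^esub> (y \<otimes>\<^bsub>free_group\<^esub> z)"
    by (simp add: letters_inject[symmetric] letters_mult foldr_assoc)
  show "\<one>\<^bsub>free_group\<^esub> \<otimes>\<^bsub>free_group\<^esub> x = x"
    by (simp add: letters_inject[symmetric] letters_mult letters_one)
  show "\<exists>y\<in>carrier free_group. y \<otimes>\<^bsub>free_group\<^esub> x = \<one>\<^bsub>free_group\<^esub>"
    by (rule bexI[of _ "Abs_free_word (rev (map flip (letters x)))"])
       (simp_all add: letters_inject[symmetric] letters_mult letters_one letters_Abs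
          reduced_inverse foldr_inverse del: rev_map)
qed simp_all

lemma free_group_induct [case_names one gen inv]:
  assumes "P \<one>\<^bsub>free_group\<^esub>"
    and "\<And>a u. P u \<Longrightarrow> P (gen a \<otimes>\<^bsub>free_group\<^esub> u)"
    and "\<And>a u. P u \<Longrightarrow> P (inv\<^bsub>free_group\<^esub> gen a \<otimes>\<^bsub>free_group\<^esub> u)"
  shows "P u"
proof -
  interpret F: group free_group by (rule group_free_group)
  have inv: "letters (inv\<^bsub>free_group\<^esub> gen a) = [(a, False)]" for a :: 'a
  proof -
    have r: "reduced_word [(a, False)]" by (simp add: reduced_word_def)
    have "Abs_free_word [(a, False)] \<otimes>\<^bsub>free_group\<^esub> gen a = \<one>\<^bsub>free_group\<^esub>"
      by (simp add: letters_inject[symmetric] letters_mult letters_one letters_gen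
          letters_Abs[OF r] flip_def)
    hence "inv\<^bsub>free_group\<^esub> gen a = Abs_free_word [(a, False)]"
      by (intro F.inv_equality) simp_all
    thus ?thesis by (simp add: letters_Abs[OF r])
  qed
  have "reduced_word w \<Longrightarrow> P (Abs_free_word w)" for w
  proof (induction w)
    case Nil
    thus ?case using assms(1) by (simp add: free_group_def)
  next
    case (Cons l w)
    obtain a s where l: "l = (a, s)" by (cases l)
    have w: "reduced_word w" and P: "P (Abs_free_word w)"
      using Cons by (auto simp: reduced_Cons)
    have "Abs_free_word (l # w) =
            (if s then gen a else inv\<^bsub>free_group\<^esub> gen a) \<otimes>\<^bsub>free_group\<^esub> Abs_free_word w"
      using Cons.prems w
      by (cases s) (simp_all add: letters_inject[symmetric] letters_mult letters_gen inv letters_Abs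
          red_cons_reduced l)
    thus ?case using assms(2,3)[OF P] by simp
  qed
  from this[of "letters u"] show ?thesis by (simp add: letters_inverse)
qed

lemma free_group_universal:
  fixes H (structure)
  assumes "group H" and f: "\<And>a. f a \<in> carrier H"
  shows "\<exists>\<phi>\<in>hom free_group H. \<forall>a. \<phi> (gen a) = f a"
proof -
  interpret H: group H by fact
  define ev where "ev l = (if snd l then f (fst l) else inv (f (fst l)))" for l
  define \<phi> where "\<phi> w = foldr (\<lambda>l x. ev l \<otimes> x) w \<one>" for w
  have ev [simp]: "ev l \<in> carrier H" for l by (simp add: ev_def f)
  have \<phi> [simp]: "\<phi> w \<in> carrier H" for w by (induction w) (simp_all add: \<phi>_def)
  have Cons: "\<phi> (l # w) = ev l \<otimes> \<phi> w" for l w by (simp add: \<phi>_def)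
  have flip: "ev l \<otimes> (ev (flip l) \<otimes> x) = x" if "x \<in> carrier H" for l x
    using that f by (auto simp: ev_def flip_def H.inv_solve_left' simp flip: H.m_assoc)
  have red: "\<phi> (red_cons l w) = ev l \<otimes> \<phi> w" for l w
    by (cases w) (auto simp: Cons flip)
  have mult: "\<phi> (foldr red_cons u v) = \<phi> u \<otimes> \<phi> v" for u v
    by (induction u) (simp_all add: red Cons H.m_assoc, simp add: \<phi>_def[of "[]"])
  show ?thesis
  proof (rule bexI)
    show "\<forall>a. \<phi> (letters (gen a)) = f a"
      by (simp add: letters_gen \<phi>_def ev_def f)
    show "(\<lambda>u. \<phi> (letters u)) \<in> hom free_group H"
      by (rule homI) (simp_all add: letters_mult mult)
  qed
qed

lemma free_group_hom_eq:
  assumes "group H" "\<phi> \<in> hom free_group H" "\<psi> \<in> hom free_group H"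
    and "\<And>a. \<phi> (gen a) = \<psi> (gen a)"
  shows "\<phi> u = \<psi> u"
proof -
  interpret p: group_hom free_group H \<phi>
    using assms group_free_group by (simp add: group_hom_def group_hom_axioms_def)
  interpret q: group_hom free_group H \<psi>
    using assms group_free_group by (simp add: group_hom_def group_hom_axioms_def)
  show ?thesis
    by (induction u rule: free_group_induct) (simp_all add: assms(4))
qed

section \<open>Existence of the free shift and of the induced automorphism\<close>

lemma free_shift_exists:
  "\<exists>\<beta> \<in> iso free_group free_group. \<forall>i::int. \<beta> (gen i) = gen (i + 1)"
proof -
  obtain \<beta> where b: "\<beta> \<in> hom free_group free_group" "\<And>i::int. \<beta> (gen i) = gen (i + 1)"
    using free_group_universal[OF group_free_group, of "\<lambda>i::int. gen (i + 1)"] by auto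
  obtain \<gamma> where c: "\<gamma> \<in> hom free_group free_group" "\<And>i::int. \<gamma> (gen i) = gen (i - 1)"
    using free_group_universal[OF group_free_group, of "\<lambda>i::int. gen (i - 1)"] by auto
  have id: "(\<lambda>u. u) \<in> hom free_group (free_group :: int free_word monoid)" by (simp add: hom_def)
  have "\<beta> (\<gamma> u) = u" "\<gamma> (\<beta> u) = u" for u
    using free_group_hom_eq[OF group_free_group hom_compose[OF c(1) b(1)] id, of u]
      free_group_hom_eq[OF group_free_group hom_compose[OF b(1) c(1)] id, of u]
    by (simp_all add: b c)
  hence "bij \<beta>" by (intro o_bij[of \<gamma>]) auto
  thus ?thesis using b by (auto simp: iso_def)
qed

definition reindex :: "('a \<Rightarrow> 'a) \<Rightarrow> ('a ell2 \<Rightarrow>\<^sub>L 'a ell2)" where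
  "reindex p = Blinfun (\<lambda>\<xi>. Abs_ell2 (\<lambda>h. ell2_apply \<xi> (p h)))"

lemma reindex_apply [simp]:
  assumes "bij p"
  shows "ell2_apply (blinfun_apply (reindex p) \<xi>) h = ell2_apply \<xi> (p h)"
proof -
  define f where "f \<xi> = Abs_ell2 (\<lambda>h. ell2_apply \<xi> (p h))" for \<xi>
  have f: "ell2_apply (f \<xi>) h = ell2_apply \<xi> (p h)" for \<xi> h
    unfolding f_def using summable_on_reindex_bij_betw[OF assms, of "\<lambda>h. (cmod (ell2_apply \<xi> h))\<^sup>2"]
    by (subst ell2_apply_Abs) (auto simp: ell2_summable)
  have "bounded_linear f"
  proof (rule bounded_linear_intro[where K=1])
    fix \<xi> :: "'a ell2"
    have "(norm (f \<xi>))\<^sup>2 = (norm \<xi>)\<^sup>2"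
      unfolding ell2_norm_sq f
      using infsum_reindex_bij_betw[OF assms, of "\<lambda>h. (cmod (ell2_apply \<xi> h))\<^sup>2"] by simp
    thus "norm (f \<xi>) \<le> norm \<xi> * 1" by simp
  qed (auto intro!: ell2_eqI simp: f)
  thus ?thesis unfolding reindex_def f_def[symmetric] by (simp add: bounded_linear_Blinfun_apply f)
qed

lemma reindex_bounded_ops: "bij p \<Longrightarrow> reindex p \<in> bounded_ops"
  by (auto simp: bounded_ops_def intro!: ell2_eqI)

lemma cinner_reindex:
  assumes "bij p"
  shows "cinner (blinfun_apply (reindex p) x) y = cinner x (blinfun_apply (reindex (inv_into UNIV p)) y)"
  unfolding cinner_def reindex_apply[OF assms] reindex_apply[OF bij_imp_bij_inv[OF assms]]
  using infsum_reindex_bij_betw[OF assms, of "\<lambda>h. ell2_apply x h * cnj (ell2_apply y (inv_into UNIV p h))"]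
  by (simp add: inv_f_f[OF bij_is_inj[OF assms]])

lemma cstar_subalgebra_bounded_ops: "cstar_subalgebra bounded_ops"
  unfolding cstar_subalgebra_def
proof (intro conjI ballI allI)
  show "closed bounded_ops" by (rule closed_bounded_ops)
  show "adj T \<in> bounded_ops" if "T \<in> bounded_ops" for T
    using that by (rule adj_in_bounded_ops)
qed (auto simp: bounded_ops_def blinfun.add_left cscale_add mult.commute intro!: ell2_eqI)

lemma cstar_subalgebra_hull:
  assumes "S \<subseteq> bounded_ops" shows "cstar_subalgebra (cstar_subalgebra hull S)"
proof -
  have "cstar_subalgebra hull S \<subseteq> bounded_ops"
    using assms cstar_subalgebra_bounded_ops by (rule hull_minimal)
  moreover have "closed (cstar_subalgebra hull S)"
    unfolding hull_def by (rule closed_Inter) (auto simp: cstar_subalgebra_def)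
  ultimately show ?thesis
    unfolding cstar_subalgebra_def[of "cstar_subalgebra hull S"]
    by (auto simp: hull_def cstar_subalgebra_def)
qed

definition conj_op :: "('a \<Rightarrow> 'a) \<Rightarrow> ('a ell2 \<Rightarrow>\<^sub>L 'a ell2) \<Rightarrow> ('a ell2 \<Rightarrow>\<^sub>L 'a ell2)" where
  "conj_op p T = reindex (inv_into UNIV p) o\<^sub>L T o\<^sub>L reindex p"

lemma reindex_inv:
  assumes "bij p"
  shows "blinfun_apply (reindex p) (blinfun_apply (reindex (inv_into UNIV p)) x) = x"
    and "blinfun_apply (reindex (inv_into UNIV p)) (blinfun_apply (reindex p) x) = x"
  using assms by (auto intro!: ell2_eqI simp: bij_imp_bij_inv bij_is_inj bij_is_surj surj_f_inv_f)

lemma conj_op_algebra: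
  assumes p: "bij p"
  shows "conj_op p (S + T) = conj_op p S + conj_op p T"
    and "conj_op p (op_scale c T) = op_scale c (conj_op p T)"
    and "conj_op p (S o\<^sub>L T) = conj_op p S o\<^sub>L conj_op p T"
    and "conj_op p (conj_op (inv_into UNIV p) T) = T" "conj_op (inv_into UNIV p) (conj_op p T) = T"
    and "T \<in> bounded_ops \<Longrightarrow> conj_op p T \<in> bounded_ops"
    and "T \<in> bounded_ops \<Longrightarrow> conj_op p (adj T) = adj (conj_op p T)"
proof -
  note [simp] = conj_op_def reindex_inv[OF p] inv_inv_eq[OF p]
  note q = bij_imp_bij_inv[OF p]
  show "conj_op p (S + T) = conj_op p S + conj_op p T"
    by (auto intro!: blinfun_eqI simp: blinfun.add_left blinfun.add_right)
  show "conj_op p (op_scale c T) = op_scale c (conj_op p T)"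
    by (auto intro!: blinfun_eqI ell2_eqI simp: q)
  show "conj_op p (S o\<^sub>L T) = conj_op p S o\<^sub>L conj_op p T"
    "conj_op p (conj_op (inv_into UNIV p) T) = T" "conj_op (inv_into UNIV p) (conj_op p T) = T"
    by (auto intro!: blinfun_eqI)
  show "conj_op p T \<in> bounded_ops" if "T \<in> bounded_ops"
    using that reindex_bounded_ops[OF p] reindex_bounded_ops[OF q] by (simp add: bounded_ops_def)
  show "conj_op p (adj T) = adj (conj_op p T)" if T: "T \<in> bounded_ops"
    by (rule adj_eqI[symmetric])
       (simp add: cinner_reindex[OF q] cinner_adj[OF T] cinner_reindex[OF p])
qed

lemma cstar_subalgebra_conj:
  assumes p: "bij p" and A: "cstar_subalgebra A"
  shows "cstar_subalgebra {T \<in> bounded_ops. conj_op p T \<in> A}"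
  unfolding cstar_subalgebra_def
proof (intro conjI)
  have "bounded_linear (conj_op p)"
    unfolding conj_op_def
    by (intro bounded_linear_intro[where K="norm (reindex (inv_into UNIV p)) * norm (reindex p)"])
       (auto intro!: blinfun_eqI order_trans[OF norm_blinfun_compose] order_trans[OF mult_right_mono[OF norm_blinfun_compose]]
         simp: blinfun.add_left blinfun.add_right blinfun.scaleR_left blinfun.scaleR_right mult_ac)
  hence "continuous_on UNIV (conj_op p)" by (rule linear_continuous_on)
  moreover have "closed A" using A by (simp add: cstar_subalgebra_def)
  ultimately have "closed (conj_op p -` A)" by (simp add: continuous_on_closed_vimage)
  hence "closed (bounded_ops \<inter> conj_op p -` A)" by (intro closed_Int closed_bounded_ops)
  thus "closed {T \<in> bounded_ops. conj_op p T \<in> A}" by (simp add: Int_def vimage_def)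
  have "conj_op p 0 = 0" by (auto intro!: blinfun_eqI simp: conj_op_def)
  moreover have "0 \<in> A" and "0 \<in> bounded_ops"
    using A cstar_subalgebra_bounded_ops unfolding cstar_subalgebra_def by blast+
  ultimately show "0 \<in> {T \<in> bounded_ops. conj_op p T \<in> A}" by simp
qed (use A cstar_subalgebra_bounded_ops in
      \<open>auto simp: cstar_subalgebra_def conj_op_algebra[OF p]\<close>)

lemma bij_left_mult_inv:
  assumes "group G" "carrier G = UNIV"
  shows "bij (\<lambda>h. inv\<^bsub>G\<^esub> g \<otimes>\<^bsub>G\<^esub> h)"
proof -
  interpret group G by fact
  show ?thesis
    by (rule o_bij[of "\<lambda>h. g \<otimes>\<^bsub>G\<^esub> h"]) (auto simp: assms(2) simp flip: m_assoc)
qed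

lemma left_regular_apply:
  assumes "group G" "carrier G = UNIV"
  shows "ell2_apply (blinfun_apply (left_regular G g) \<xi>) h = ell2_apply \<xi> (inv\<^bsub>G\<^esub> g \<otimes>\<^bsub>G\<^esub> h)"
  using reindex_apply[OF bij_left_mult_inv[OF assms]] by (simp add: left_regular_def reindex_def)

lemma left_regular_ket:
  assumes "group G" "carrier G = UNIV"
  shows "blinfun_apply (left_regular G g) (ket h) = ket (g \<otimes>\<^bsub>G\<^esub> h)"
proof -
  interpret group G by fact
  have "inv\<^bsub>G\<^esub> g \<otimes>\<^bsub>G\<^esub> k = h \<longleftrightarrow> k = g \<otimes>\<^bsub>G\<^esub> h" for k
    by (simp add: assms(2) inv_solve_left')
  thus ?thesis by (auto intro!: ell2_eqI simp: left_regular_apply[OF assms] ell2_apply_ket)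
qed

lemma left_regular_bounded_ops:
  assumes "group G" "carrier G = UNIV" shows "left_regular G g \<in> bounded_ops"
  using reindex_bounded_ops[OF bij_left_mult_inv[OF assms]] by (simp add: left_regular_def reindex_def)

lemma induced_automorphism_exists:
  assumes G: "group G" "carrier G = UNIV" and \<beta>: "\<beta> \<in> iso G G"
  shows "\<exists>\<alpha>. cstar_automorphism (reduced_cstar G) \<alpha> \<and>
           (\<forall>g. \<alpha> (left_regular G g) = left_regular G (\<beta> g))"
proof -
  interpret b: group_hom G G \<beta>
    using \<beta> G by (simp add: group_hom_def group_hom_axioms_def iso_def)
  let ?A = "reduced_cstar G" and ?L = "left_regular G"
  have A: "cstar_subalgebra ?A"
    unfolding reduced_cstar_def
    by (rule cstar_subalgebra_hull) (auto simp: left_regular_bounded_ops[OF G])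
  have sub: "?A \<subseteq> bounded_ops" using A by (simp add: cstar_subalgebra_def)
  have L: "?L g \<in> ?A" for g
    unfolding reduced_cstar_def by (rule hull_inc) (simp add: G)
  have bij: "bij \<beta>" using \<beta> by (simp add: iso_def G)
  note bij' = bij_imp_bij_inv[OF bij]
  have act: "conj_op \<beta> (?L g) = ?L (\<beta> g)" for g
  proof (rule blinfun_eqI, rule ell2_eqI)
    fix x h
    have "\<beta> (inv\<^bsub>G\<^esub> g \<otimes>\<^bsub>G\<^esub> inv_into UNIV \<beta> h) = inv\<^bsub>G\<^esub> (\<beta> g) \<otimes>\<^bsub>G\<^esub> h"
      by (simp add: G(2) surj_f_inv_f[OF bij_is_surj[OF bij]])
    thus "ell2_apply (blinfun_apply (conj_op \<beta> (?L g)) x) h = ell2_apply (blinfun_apply (?L (\<beta> g)) x) h"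
      by (simp add: conj_op_def bij bij' left_regular_apply[OF G])
  qed
  have act': "conj_op (inv_into UNIV \<beta>) (?L g) = ?L (inv_into UNIV \<beta> g)" for g
    using act[of "inv_into UNIV \<beta> g"] conj_op_algebra(5)[OF bij]
    by (metis surj_f_inv_f[OF bij_is_surj[OF bij]])
  have "?A \<subseteq> {T \<in> bounded_ops. conj_op \<beta> T \<in> ?A}"
    unfolding reduced_cstar_def[of G]
    by (rule hull_minimal)
       (use cstar_subalgebra_conj[OF bij A] L in
         \<open>auto simp: act left_regular_bounded_ops[OF G] reduced_cstar_def\<close>)
  moreover have "?A \<subseteq> {T \<in> bounded_ops. conj_op (inv_into UNIV \<beta>) T \<in> ?A}"
    unfolding reduced_cstar_def[of G]
    by (rule hull_minimal)
       (use cstar_subalgebra_conj[OF bij' A] L in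
         \<open>auto simp: act' left_regular_bounded_ops[OF G] reduced_cstar_def\<close>)
  ultimately have "bij_betw (conj_op \<beta>) ?A ?A"
    by (intro bij_betw_byWitness[where f'="conj_op (inv_into UNIV \<beta>)"])
       (auto simp: conj_op_algebra(4,5)[OF bij])
  hence "cstar_automorphism ?A (conj_op \<beta>)"
    using sub unfolding cstar_automorphism_def linear_map_on_def
    by (auto simp: conj_op_algebra[OF bij] bij_betw_def)
  thus ?thesis using act by blast
qed

end

(* For a reduced word g with letters indexed by a finite set I of integers, the n-th shift of g maps
   every word not beginning with a letter indexed by I + n to one that does. For shifts n far apart
   these sets of words are disjoint, and a ping-pong estimate bounds the norm of a sum of N
   unimodular multiples of the corresponding unitaries by 2 sqrt N. Since a state is bounded, its
   values at the shifts of g tend to 0 when g is nontrivial. The general case follows because the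
   group algebra is dense and the states obtained by composing with powers of the automorphism
   are uniformly bounded. *)

theory Submission
  imports Defs
begin

section \<open>Boundedness of states\<close>

text \<open>\<open>state_on\<close> grants only positivity and normalisation, so continuity of
  states has to be earned. For self-adjoint \<open>h\<close> with norm below 1, the operator 1 - h
  is shown to have the form \<open>adj y\<close> times \<open>y\<close> with \<open>y\<close> in the
  same algebra; this takes the place of functional calculus. The resulting constant 2 is not sharp,
  but any constant common to all states serves: the ping-pong bound grows like sqrt N, while N
  aligned values of size e add up to N e. No norm estimate for the automorphism enters: a state
  composed with one of its powers is again a state and so obeys the same bound. Density has its own
  obstacle, since \<open>reduced_cstar\<close> is a hull, an intersection taken from outside; the
  closure of the span of the translations must itself be recognised as a C*-subalgebra.\<close>

lemma adj_add:
  assumes "S \<in> bounded_ops" "T \<in> bounded_ops"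
  shows "adj (S + T) = adj S + adj T"
  by (rule adj_eqI)
     (simp add: blinfun.add_left cinner_add_left cinner_add_right cinner_adj[OF assms(1)]
        cinner_adj[OF assms(2)])

lemma adj_op_scale:
  assumes "T \<in> bounded_ops"
  shows "adj (op_scale c T) = op_scale (cnj c) (adj T)"
  by (rule adj_eqI) (simp add: cinner_cscale_left cinner_cscale_right cinner_adj[OF assms])

lemma adj_compose:
  assumes "S \<in> bounded_ops" "T \<in> bounded_ops"
  shows "adj (S o\<^sub>L T) = adj T o\<^sub>L adj S"
  by (rule adj_eqI) (simp add: cinner_adj[OF assms(1)] cinner_adj[OF assms(2)])

lemma adj_adj:
  assumes "T \<in> bounded_ops"
  shows "adj (adj T) = T"
proof (rule adj_eqI)
  fix x y
  show "cinner (blinfun_apply (adj T) x) y = cinner x (blinfun_apply T y)"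
    using cinner_adj[OF assms, of y x] cinner_cnj by metis
qed

lemma norm_op_scale [simp]: "norm (op_scale c T) = cmod c * norm T"
proof -
  have le: "norm (op_scale c T) \<le> cmod c * norm T" for c and T :: "'a ell2 \<Rightarrow>\<^sub>L 'a ell2"
  proof (rule norm_blinfun_bound)
    fix x
    show "norm (blinfun_apply (op_scale c T) x) \<le> cmod c * norm T * norm x"
      using mult_left_mono[OF norm_blinfun[of T x], of "cmod c"] by (simp add: mult.assoc)
  qed simp
  show ?thesis
  proof (cases "c = 0")
    case False
    have "op_scale (inverse c) (op_scale c T) = T"
      using False by (auto intro!: blinfun_eqI ell2_eqI)
    hence "norm T \<le> inverse (cmod c) * norm (op_scale c T)"
      using le[of "inverse c" "op_scale c T"] by (simp add: norm_inverse)
    hence "cmod c * norm T \<le> norm (op_scale c T)"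
      using False by (simp add: field_simps)
    thus ?thesis using le[of c T] by simp
  qed (use le[of 0 T] in simp)
qed

text \<open>Pairing \<open>adj T x\<close> with itself and moving one adjoint across bounds its
  squared norm by norm T * norm (adj T x) * norm x; one factor then cancels.\<close>

lemma norm_adj_le:
  assumes "T \<in> bounded_ops"
  shows "norm (adj T) \<le> norm T"
proof (rule norm_blinfun_bound)
  fix x
  let ?y = "blinfun_apply (adj T) x"
  have "(norm ?y)\<^sup>2 = Re (cinner ?y ?y)"
    by (simp add: power2_norm_eq_inner inner_ell2_def)
  also have "\<dots> = Re (cinner (blinfun_apply T ?y) x)"
    by (simp add: cinner_adj[OF assms])
  also have "\<dots> \<le> norm (blinfun_apply T ?y) * norm x"
    using complex_Re_le_cmod cinner_Cauchy_Schwarz order_trans by blast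
  also have "\<dots> \<le> norm T * norm ?y * norm x"
    by (intro mult_right_mono norm_blinfun) simp
  finally have "norm ?y * norm ?y \<le> (norm T * norm x) * norm ?y"
    by (simp add: power2_eq_square mult_ac)
  thus "norm ?y \<le> norm T * norm x"
    by (cases "norm ?y = 0") (auto dest: mult_right_le_imp_le)
qed simp

lemma norm_adj:
  assumes "T \<in> bounded_ops"
  shows "norm (adj T) = norm T"
  using norm_adj_le[OF assms] norm_adj_le[OF adj_in_bounded_ops[OF assms]] adj_adj[OF assms] by simp

text \<open>\<open>cstar_subalgebra\<close> speaks only of sums and \<open>op_scale\<close>. This
  rule and the next bring real multiples and differences into that form, so that membership and
  \<open>adj\<close> can be computed.\<close>

lemma scaleR_eq_op_scale: "r *\<^sub>R T = op_scale (of_real r) T"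
  by (auto intro!: blinfun_eqI ell2_eqI simp: blinfun.scaleR_left)

lemma minus_eq_op_scale: "- T = op_scale (-1) T"
  by (auto intro!: blinfun_eqI ell2_eqI simp: blinfun.minus_left)

text \<open>
  Writing the square root as \<open>1 - y\<close>, the equation \<open>(1 - y)\<^sup>2 = 1 - h\<close> becomes the fixed point
  equation \<open>y = (h + y\<^sup>2) / 2\<close>, whose right-hand side is a contraction of the ball of
  radius \<open>\<parallel>h\<parallel>\<close>.
\<close>

lemma self_adjoint_sqrt:
  assumes A: "unital_cstar_algebra A" and h: "h \<in> A" "adj h = h" "norm h < 1"
  obtains y where "y \<in> A" "adj y o\<^sub>L y = id_blinfun - h"
proof -
  let ?r = "norm h"
  define f where "f y = (1/2) *\<^sub>R (h + (y o\<^sub>L y))" for y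
  \<comment> \<open>Self-adjointness is built into the set so that the final z = 1 - y is
    self-adjoint and its square is \<open>adj z\<close> times \<open>z\<close>.\<close>
  define S where "S = {y \<in> A. adj y = y \<and> norm y \<le> ?r}"
  have Asub: "A \<subseteq> bounded_ops" and "closed A" and A0: "0 \<in> A" and id: "id_blinfun \<in> A"
    and add: "\<And>S T. S \<in> A \<Longrightarrow> T \<in> A \<Longrightarrow> S + T \<in> A"
    and scale: "\<And>c T. T \<in> A \<Longrightarrow> op_scale c T \<in> A"
    and comp: "\<And>S T. S \<in> A \<Longrightarrow> T \<in> A \<Longrightarrow> S o\<^sub>L T \<in> A"
    using A by (auto simp: unital_cstar_algebra_def cstar_subalgebra_def)
  have bo: "\<And>T. T \<in> A \<Longrightarrow> T \<in> bounded_ops" using Asub by blast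
  have fS: "f y \<in> S" if "y \<in> S" for y
  proof -
    from that have y: "y \<in> A" "adj y = y" "norm y \<le> ?r" by (auto simp: S_def)
    have "norm (h + (y o\<^sub>L y)) \<le> ?r + norm y * norm y"
      by (rule norm_triangle_le) (simp add: norm_blinfun_compose)
    also have "norm y * norm y \<le> ?r * 1"
      using y(3) h(3) by (intro mult_mono) auto
    finally have "norm (f y) \<le> ?r" by (simp add: f_def)
    moreover have "f y \<in> A"
      unfolding f_def scaleR_eq_op_scale by (intro scale add comp h y)
    moreover have "adj (f y) = f y"
      unfolding f_def scaleR_eq_op_scale
      by (simp add: adj_op_scale adj_add adj_compose bo add comp h y)
    ultimately show ?thesis by (simp add: S_def)
  qed
  \<comment> \<open>\<open>adj\<close> is a definite description, with no continuity at hand.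
    Self-adjointness is therefore restated through inner products, each of which is continuous in
    the operator.\<close>
  have clS: "closed S"
  proof -
    have cl: "closed {y. cinner (blinfun_apply y x) z = cinner x (blinfun_apply y z)}"
      for x z :: "'a ell2"
    proof -
      have "bounded_linear (\<lambda>y :: 'a ell2 \<Rightarrow>\<^sub>L 'a ell2. cinner (blinfun_apply y x) z)" for x z
        by (rule bounded_linear_compose[OF bounded_linear_cinner_left blinfun.bounded_linear_left])
      note c = linear_continuous_on[OF this]
      have "continuous_on UNIV (\<lambda>y. cnj (cinner (blinfun_apply y z) x))"
        by (intro continuous_on_cnj c)
      hence "continuous_on UNIV (\<lambda>y. cinner x (blinfun_apply y z))"
        by (simp flip: cinner_cnj)
      thus ?thesis using c by (intro closed_Collect_eq)
    qed
    have "closed {y. \<forall>x z :: 'a ell2. cinner (blinfun_apply y x) z = cinner x (blinfun_apply y z)}"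
      by (intro closed_Collect_all cl)
    moreover have "(\<forall>x z. cinner (blinfun_apply y x) z = cinner x (blinfun_apply y z)) \<longleftrightarrow> adj y = y"
      if "y \<in> A" for y
      using cinner_adj[OF bo[OF that]] adj_eqI[of y y] by auto
    hence "S = A \<inter> {y. \<forall>x z. cinner (blinfun_apply y x) z = cinner x (blinfun_apply y z)}
        \<inter> cball 0 ?r"
      by (auto simp: S_def)
    ultimately show ?thesis using \<open>closed A\<close> by (auto intro!: closed_Int)
  qed
  have "\<exists>!y\<in>S. f y = y"
  proof (rule Banach_fix[of S ?r f])
    show "complete S" using clS by (simp add: complete_eq_closed)
    show "S \<noteq> {}" using h by (auto simp: S_def)
    show "f ` S \<subseteq> S" using fS by blast
    show "dist (f x) (f y) \<le> ?r * dist x y" if "x \<in> S" "y \<in> S" for x y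
    proof -
      have x: "norm x \<le> ?r" and y: "norm y \<le> ?r" using that by (auto simp: S_def)
      \<comment> \<open>The difference of squares is split as x(x - y) + (x - y)y because x and y
        need not commute.\<close>
      have "f x - f y = (1/2) *\<^sub>R ((x o\<^sub>L (x - y)) + ((x - y) o\<^sub>L y))"
        by (auto intro!: blinfun_eqI simp: f_def blinfun.add_left blinfun.diff_left
              blinfun.scaleR_left blinfun.diff_right algebra_simps)
      also have "norm \<dots> \<le> (1/2) * (norm x * norm (x - y) + norm (x - y) * norm y)"
        using norm_triangle_mono[OF norm_blinfun_compose[of x "x - y"]
            norm_blinfun_compose[of "x - y" y]] by simp
      also have "\<dots> \<le> (1/2) * (?r * norm (x - y) + norm (x - y) * ?r)"
        using x y by (intro mult_left_mono add_mono mult_right_mono) auto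
      finally show "dist (f x) (f y) \<le> ?r * dist x y"
        by (simp add: dist_norm mult.commute)
    qed
  qed (use h in auto)
  then obtain y where y: "y \<in> S" "f y = y" by blast
  hence yA: "y \<in> A" "adj y = y" by (auto simp: S_def)
  have fp: "h + (y o\<^sub>L y) = y + y"
    using arg_cong[OF y(2), of "\<lambda>z. 2 *\<^sub>R z"] by (simp add: f_def scaleR_2)
  define z where "z = id_blinfun + op_scale (-1) y"
  have z: "z \<in> A" unfolding z_def by (intro add scale id yA)
  have "adj id_blinfun = (id_blinfun :: 'a ell2 \<Rightarrow>\<^sub>L 'a ell2)" by (rule adj_eqI) simp
  hence "adj z = z"
    unfolding z_def using yA by (simp add: adj_add adj_op_scale bo id scale)
  moreover have "z o\<^sub>L z = id_blinfun - h"
  proof (rule blinfun_eqI)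
    fix x
    have "blinfun_apply h x + blinfun_apply y (blinfun_apply y x)
        = blinfun_apply y x + blinfun_apply y x"
      using arg_cong[OF fp, of "\<lambda>T. blinfun_apply T x"] by (simp add: blinfun.add_left)
    hence "blinfun_apply h x = blinfun_apply y x + blinfun_apply y x - blinfun_apply y (blinfun_apply y x)"
      by (simp add: eq_diff_eq)
    moreover have zv: "blinfun_apply z v = v - blinfun_apply y v" for v
      by (simp add: z_def minus_eq_op_scale[symmetric] blinfun.diff_left blinfun.add_left blinfun.minus_left)
    ultimately show "blinfun_apply (z o\<^sub>L z) x = blinfun_apply (id_blinfun - h) x"
      by (simp add: zv blinfun.diff_left blinfun.diff_right)
  qed
  ultimately show ?thesis using that z by metis
qed

text \<open>For real t with |t| * norm h < 1, the operator 1 - t h is \<open>adj y\<close> times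
  \<open>y\<close>, so 1 - t * \<phi>(h) is a nonnegative real. One nonzero t makes \<phi>(h) real;
  letting t approach both ends of the range bounds it.\<close>

lemma state_self_adjoint_bound:
  assumes A: "unital_cstar_algebra A" and \<phi>: "state_on A \<phi>" and h: "h \<in> A" "adj h = h"
  shows "cmod (\<phi> h) \<le> norm h"
proof -
  have lin: "\<And>S T. S \<in> A \<Longrightarrow> T \<in> A \<Longrightarrow> \<phi> (S + T) = \<phi> S + \<phi> T"
    "\<And>c T. T \<in> A \<Longrightarrow> \<phi> (op_scale c T) = c * \<phi> T"
    and pos: "\<And>T. T \<in> A \<Longrightarrow> \<phi> (adj T o\<^sub>L T) \<in> \<real>\<^sub>\<ge>\<^sub>0" and one: "\<phi> id_blinfun = 1"
    using \<phi> by (auto simp: state_on_def)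
  have id: "id_blinfun \<in> A" and sc: "\<And>c T. T \<in> A \<Longrightarrow> op_scale c T \<in> A" and hb: "h \<in> bounded_ops"
    using A h by (auto simp: unital_cstar_algebra_def cstar_subalgebra_def)
  have key: "1 - of_real t * \<phi> h \<in> \<real>\<^sub>\<ge>\<^sub>0" if "\<bar>t\<bar> * norm h < 1" for t
  proof -
    have "op_scale (of_real t) h \<in> A" "adj (op_scale (of_real t) h) = op_scale (of_real t) h"
      "norm (op_scale (of_real t) h) < 1"
      using h that by (simp_all add: sc adj_op_scale hb)
    from self_adjoint_sqrt[OF A this] obtain y where
      y: "y \<in> A" "adj y o\<^sub>L y = id_blinfun - op_scale (of_real t) h" by blast
    have "id_blinfun - op_scale (of_real t) h = id_blinfun + op_scale (of_real (- t)) h"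
      by (auto intro!: blinfun_eqI ell2_eqI simp: blinfun.diff_left blinfun.add_left blinfun.minus_left)
    hence "\<phi> (adj y o\<^sub>L y) = \<phi> (id_blinfun + op_scale (of_real (- t)) h)"
      by (simp only: y(2))
    also have "\<dots> = 1 - of_real t * \<phi> h"
      using h by (simp add: lin id sc one)
    finally have "\<phi> (adj y o\<^sub>L y) = 1 - of_real t * \<phi> h" .
    thus ?thesis using pos[OF y(1)] by simp
  qed
  \<comment> \<open>Any nonzero admissible parameter would do; the added 1 covers
    \<open>h = 0\<close>.\<close>
  define s where "s = 1 / (norm h + 1)"
  have s: "s > 0" by (simp add: s_def add_nonneg_pos)
  have "1 - of_real s * \<phi> h \<in> \<real>\<^sub>\<ge>\<^sub>0"
    by (rule key) (simp add: s_def abs_of_pos add_nonneg_pos divide_less_eq)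
  hence "Im (\<phi> h) = 0" using s by (auto simp: complex_nonneg_Reals_iff)
  moreover have "\<bar>Re (\<phi> h)\<bar> \<le> norm h"
  proof (rule field_le_epsilon)
    fix e :: real assume e: "e > 0"
    \<comment> \<open>This stays strictly inside the admissible range and tends to its end 1 / norm
      h as e tends to 0; it is also defined when \<open>h = 0\<close>.\<close>
    define t where "t = 1 / (norm h + e)"
    have t: "t > 0" and te: "t * (norm h + e) = 1" using e
      by (simp_all add: t_def add_nonneg_pos add_nonneg_pos[THEN less_imp_neq, symmetric])
    have "t * norm h < 1" using te t e by (simp add: distrib_left) (metis less_add_same_cancel1 mult_pos_pos)
    hence "1 - of_real t * \<phi> h \<in> \<real>\<^sub>\<ge>\<^sub>0" "1 - of_real (- t) * \<phi> h \<in> \<real>\<^sub>\<ge>\<^sub>0"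
      using t by (intro key; simp)+
    hence "t * \<bar>Re (\<phi> h)\<bar> \<le> t * (norm h + e)"
      using t te by (auto simp: complex_nonneg_Reals_iff abs_if)
    thus "\<bar>Re (\<phi> h)\<bar> \<le> norm h + e" using t by simp
  qed
  ultimately show ?thesis by (simp add: cmod_def)
qed

text \<open>The factor 2 comes from the Cartesian decomposition T = a + i b, whose self-adjoint
  parts have norm at most norm T each.\<close>

lemma state_bound:
  assumes A: "unital_cstar_algebra A" and \<phi>: "state_on A \<phi>" and T: "T \<in> A"
  shows "cmod (\<phi> T) \<le> 2 * norm T"
proof -
  have add: "\<And>S T. S \<in> A \<Longrightarrow> T \<in> A \<Longrightarrow> S + T \<in> A" and sc: "\<And>c T. T \<in> A \<Longrightarrow> op_scale c T \<in> A"
    and ad: "\<And>T. T \<in> A \<Longrightarrow> adj T \<in> A" and bo: "\<And>T. T \<in> A \<Longrightarrow> T \<in> bounded_ops"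
    using A by (auto simp: unital_cstar_algebra_def cstar_subalgebra_def)
  define a where "a = op_scale (1/2) (T + adj T)"
  define b where "b = op_scale (- \<i>/2) (T + op_scale (-1) (adj T))"
  have aA: "a \<in> A" and bA: "b \<in> A" unfolding a_def b_def by (intro sc add ad T)+
  have sa: "adj a = a" "adj b = b"
    unfolding a_def b_def
    by (auto intro!: blinfun_eqI ell2_eqI
        simp: adj_op_scale adj_add bo sc add ad T adj_adj blinfun.add_left algebra_simps)
  have "norm (T + adj T) \<le> norm T + norm T"
    using norm_triangle_ineq[of T "adj T"] by (simp add: norm_adj bo T)
  hence na: "norm a \<le> norm T" by (simp add: a_def)
  have "norm (T + op_scale (-1) (adj T)) \<le> norm T + norm T"
    using norm_triangle_ineq[of T "op_scale (-1) (adj T)"] by (simp add: norm_adj bo T)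
  hence nb: "norm b \<le> norm T" by (simp add: b_def norm_divide)
  have "T = a + op_scale \<i> b"
    unfolding a_def b_def by (auto intro!: blinfun_eqI ell2_eqI simp: blinfun.add_left field_simps)
  hence "\<phi> T = \<phi> a + \<i> * \<phi> b"
    using \<phi> aA bA sc unfolding state_on_def by metis
  hence "cmod (\<phi> T) \<le> cmod (\<phi> a) + cmod (\<phi> b)"
    using norm_triangle_ineq[of "\<phi> a" "\<i> * \<phi> b"] by (simp add: norm_mult)
  also have "\<dots> \<le> norm a + norm b"
    by (intro add_mono state_self_adjoint_bound[OF A \<phi>] aA bA sa)
  finally show ?thesis using na nb by simp
qed

section \<open>A ping-pong estimate in the left regular representation\<close>

lemma left_regular_one:
  assumes "group G" "carrier G = UNIV"
  shows "left_regular G \<one>\<^bsub>G\<^esub> = id_blinfun"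
proof -
  interpret group G by fact
  show ?thesis by (auto intro!: blinfun_eqI ell2_eqI simp: left_regular_apply[OF assms] assms(2))
qed

lemma left_regular_mult:
  assumes "group G" "carrier G = UNIV"
  shows "left_regular G g o\<^sub>L left_regular G h = left_regular G (g \<otimes>\<^bsub>G\<^esub> h)"
proof -
  interpret group G by fact
  show ?thesis
    by (auto intro!: blinfun_eqI ell2_eqI
        simp: left_regular_apply[OF assms] assms(2) inv_mult_group m_assoc)
qed

lemma adj_left_regular:
  assumes "group G" "carrier G = UNIV"
  shows "adj (left_regular G g) = left_regular G (inv\<^bsub>G\<^esub> g)"
proof (rule adj_eqI)
  fix x y
  interpret group G by fact
  have "inv_into UNIV (\<lambda>h. inv\<^bsub>G\<^esub> g \<otimes>\<^bsub>G\<^esub> h) = (\<lambda>h. inv\<^bsub>G\<^esub> (inv\<^bsub>G\<^esub> g) \<otimes>\<^bsub>G\<^esub> h)"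
    by (rule Hilbert_Choice.inv_equality) (auto simp: assms(2) simp flip: m_assoc)
  thus "cinner (blinfun_apply (left_regular G g) x) y
      = cinner x (blinfun_apply (left_regular G (inv\<^bsub>G\<^esub> g)) y)"
    using cinner_reindex[OF bij_left_mult_inv[OF assms, of g], of x y]
    by (simp add: left_regular_def reindex_def)
qed

text \<open>The orthogonal projection onto the vectors supported in \<open>A\<close>.\<close>

definition restrict_ell2 :: "'a set \<Rightarrow> 'a ell2 \<Rightarrow> 'a ell2" where
  "restrict_ell2 A x = Abs_ell2 (\<lambda>h. if h \<in> A then ell2_apply x h else 0)"

lemma restrict_ell2_apply [simp]:
  "ell2_apply (restrict_ell2 A x) h = (if h \<in> A then ell2_apply x h else 0)"
  unfolding restrict_ell2_def
  by (subst ell2_apply_Abs)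
     (auto intro!: summable_on_comparison_test[OF ell2_summable[of x]])

lemma ell2_norm_mono:
  assumes "\<And>h. cmod (ell2_apply x h) \<le> cmod (ell2_apply y h)"
  shows "norm x \<le> norm y"
proof (rule ell2_norm_le)
  fix F :: "'a set" assume "finite F"
  have "(\<Sum>h\<in>F. (cmod (ell2_apply x h))\<^sup>2) \<le> (\<Sum>h\<in>F. (cmod (ell2_apply y h))\<^sup>2)"
    by (intro sum_mono power_mono assms) simp
  thus "(\<Sum>h\<in>F. (cmod (ell2_apply x h))\<^sup>2) \<le> (norm y)\<^sup>2"
    using ell2_sum_le_norm[OF \<open>finite F\<close>, of y] by linarith
qed simp

lemma norm_sum_restrict:
  assumes "finite K" "disjoint_family_on A K"
  shows "(norm (\<Sum>k\<in>K. restrict_ell2 (A k) (x k)))\<^sup>2 = (\<Sum>k\<in>K. (norm (restrict_ell2 (A k) (x k)))\<^sup>2)"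
proof (rule norm_sum_Pythagorean[OF assms(1)], rule pairwiseI)
  fix i j assume "i \<in> K" "j \<in> K" "i \<noteq> j"
  hence "A i \<inter> A j = {}" using assms(2) by (auto simp: disjoint_family_on_def)
  hence "cinner (restrict_ell2 (A i) (x i)) (restrict_ell2 (A j) (x j)) = 0"
    unfolding cinner_def by (intro infsum_0) auto
  thus "orthogonal (restrict_ell2 (A i) (x i)) (restrict_ell2 (A j) (x j))"
    by (simp add: orthogonal_def inner_ell2_def)
qed

text \<open>Bessel's inequality for the projections onto disjoint supports: their sum only erases
  coordinates of \<open>x\<close>, so Pythagoras applies to a vector no longer than
  \<open>x\<close>.\<close>

lemma sum_norm_restrict_le:
  assumes "finite K" "disjoint_family_on A K"
  shows "(\<Sum>k\<in>K. (norm (restrict_ell2 (A k) x))\<^sup>2) \<le> (norm x)\<^sup>2"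
proof -
  have "norm (\<Sum>k\<in>K. restrict_ell2 (A k) x) \<le> norm x"
  proof (rule ell2_norm_mono)
    fix h
    have "(\<Sum>k\<in>K. if h \<in> A k then ell2_apply x h else 0) \<in> {0, ell2_apply x h}"
    proof (cases "\<exists>k\<in>K. h \<in> A k")
      case True
      then obtain k where k: "k \<in> K" "h \<in> A k" by blast
      hence "(\<Sum>j\<in>K. if h \<in> A j then ell2_apply x h else 0)
          = (\<Sum>j\<in>K. if j = k then ell2_apply x h else 0)"
        using assms(2) by (intro sum.cong) (auto simp: disjoint_family_on_def)
      thus ?thesis using k assms(1) by simp
    qed (simp add: sum.neutral)
    thus "cmod (ell2_apply (\<Sum>k\<in>K. restrict_ell2 (A k) x) h) \<le> cmod (ell2_apply x h)"
      by (auto simp: ell2_apply_sum)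
  qed
  from power_mono[OF this, of 2] show ?thesis
    by (simp add: norm_sum_restrict[OF assms])
qed

text \<open>
  Split \<open>\<lambda>(w k) x\<close> into its parts inside and outside \<open>A k\<close>. The inside parts are pairwise
  orthogonal; the outside part only sees the restriction of \<open>x\<close> to \<open>A k\<close>, and these restrictions
  are pairwise orthogonal. Hence each half contributes at most \<open>sqrt (card K)\<close>.
\<close>

lemma norm_left_regular_ping_pong:
  assumes G: "group G" "carrier G = UNIV" and K: "finite K" "disjoint_family_on A K"
    and w: "\<And>k h. k \<in> K \<Longrightarrow> h \<notin> A k \<Longrightarrow> w k \<otimes>\<^bsub>G\<^esub> h \<in> A k"
    and z: "\<And>k. k \<in> K \<Longrightarrow> cmod (z k) \<le> 1"
  shows "norm (\<Sum>k\<in>K. op_scale (z k) (left_regular G (w k))) \<le> 2 * sqrt (card K)"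
proof (rule norm_blinfun_bound)
  interpret group G by fact
  let ?L = "left_regular G"
  have norm_L: "norm (blinfun_apply (?L g) x) = norm x" for g x
  proof -
    have "(norm (blinfun_apply (?L g) x))\<^sup>2 = (norm x)\<^sup>2"
      unfolding ell2_norm_sq left_regular_apply[OF G]
      by (rule infsum_reindex_bij_betw[OF bij_left_mult_inv[OF G]])
    thus ?thesis by simp
  qed
  fix x
  define t where "t k = cscale (z k) (blinfun_apply (?L (w k)) x)" for k
  define u where "u k = restrict_ell2 (A k) (t k)" for k
  define v where "v k = restrict_ell2 (- A k) (t k)" for k
  have nt: "norm (t k) \<le> norm x" if "k \<in> K" for k
    using mult_right_mono[OF z[OF that], of "norm x"] by (simp add: t_def norm_L)
  have nu: "norm (u k) \<le> norm x" if "k \<in> K" for k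
    using nt[OF that] ell2_norm_mono[of "u k" "t k"] by (fastforce simp: u_def)
  have nv: "norm (v k) \<le> norm (restrict_ell2 (A k) x)" if k: "k \<in> K" for k
  proof -
    have "norm (v k) \<le> norm (blinfun_apply (?L (w k)) (restrict_ell2 (A k) x))"
    proof (rule ell2_norm_mono)
      fix h
      \<comment> \<open>Contrapositive of the ping-pong hypothesis: if translation by
        \<open>w k\<close> lands outside \<open>A k\<close>, it started inside.\<close>
      have "w k \<otimes>\<^bsub>G\<^esub> (inv\<^bsub>G\<^esub> (w k) \<otimes>\<^bsub>G\<^esub> h) = h" by (simp add: G(2) flip: m_assoc)
      hence "inv\<^bsub>G\<^esub> (w k) \<otimes>\<^bsub>G\<^esub> h \<in> A k" if "h \<notin> A k" using w[OF k] that by metis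
      thus "cmod (ell2_apply (v k) h)
          \<le> cmod (ell2_apply (blinfun_apply (?L (w k)) (restrict_ell2 (A k) x)) h)"
        using mult_right_mono[OF z[OF k]]
        by (auto simp: v_def t_def left_regular_apply[OF G] norm_mult)
    qed
    thus ?thesis by (simp add: norm_L)
  qed
  have "(norm (sum u K))\<^sup>2 = (\<Sum>k\<in>K. (norm (u k))\<^sup>2)"
    unfolding u_def by (rule norm_sum_restrict[OF K])
  also have "\<dots> \<le> (\<Sum>k\<in>K. (norm x)\<^sup>2)" by (intro sum_mono power_mono nu) auto
  also have "\<dots> = (sqrt (card K) * norm x)\<^sup>2" by (simp add: power_mult_distrib)
  finally have U: "norm (sum u K) \<le> sqrt (card K) * norm x"
    by (rule power2_le_imp_le) simp
  \<comment> \<open>The outside parts \<open>v k\<close> need not be orthogonal to each other, so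
    they are summed by the triangle inequality and Cauchy-Schwarz supplies the factor sqrt (card
    K).\<close>
  have "(\<Sum>k\<in>K. norm (restrict_ell2 (A k) x))\<^sup>2
      \<le> (\<Sum>k\<in>K. (norm (restrict_ell2 (A k) x))\<^sup>2) * card K"
    by (rule sum_squared_le_sum_of_squares)
  also have "\<dots> \<le> (norm x)\<^sup>2 * card K"
    by (intro mult_right_mono sum_norm_restrict_le K) simp
  also have "\<dots> = (sqrt (card K) * norm x)\<^sup>2" by (simp add: power_mult_distrib)
  finally have "(\<Sum>k\<in>K. norm (restrict_ell2 (A k) x)) \<le> sqrt (card K) * norm x"
    by (rule power2_le_imp_le) simp
  hence V: "norm (sum v K) \<le> sqrt (card K) * norm x"
    using norm_sum[of v K] sum_mono[of K "\<lambda>k. norm (v k)", OF nv] by linarith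
  have "blinfun_apply (\<Sum>k\<in>K. op_scale (z k) (?L (w k))) x = sum t K"
    by (simp add: blinfun.sum_left t_def)
  also have "t k = u k + v k" for k by (rule ell2_eqI) (simp add: u_def v_def)
  hence "sum t K = sum u K + sum v K" by (simp add: sum.distrib)
  finally show "norm (blinfun_apply (\<Sum>k\<in>K. op_scale (z k) (?L (w k))) x)
      \<le> 2 * sqrt (card K) * norm x"
    using norm_triangle_ineq[of "sum u K" "sum v K"] U V by simp
qed simp

section \<open>The reduced group C*-algebra\<close>

lemma left_regular_in_reduced_cstar:
  assumes "carrier G = UNIV" shows "left_regular G g \<in> reduced_cstar G"
  unfolding reduced_cstar_def by (rule hull_inc) (simp add: assms)

lemma unital_cstar_algebra_reduced_cstar:
  assumes "group G" "carrier G = UNIV"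
  shows "unital_cstar_algebra (reduced_cstar G)"
  unfolding unital_cstar_algebra_def
proof
  show "cstar_subalgebra (reduced_cstar G)"
    unfolding reduced_cstar_def
    by (rule cstar_subalgebra_hull) (auto simp: left_regular_bounded_ops[OF assms])
  show "id_blinfun \<in> reduced_cstar G"
    using left_regular_in_reduced_cstar[OF assms(2), of "\<one>\<^bsub>G\<^esub>"] by (simp add: left_regular_one[OF assms])
qed

text \<open>The linear span of the translations, built one term at a time so that linear statements
  follow by induction; repeated group elements are allowed.\<close>

inductive_set group_algebra :: "('g, 'm) monoid_scheme \<Rightarrow> ('g ell2 \<Rightarrow>\<^sub>L 'g ell2) set" for G where
  zero: "0 \<in> group_algebra G"
| add_term: "T \<in> group_algebra G \<Longrightarrow> op_scale c (left_regular G g) + T \<in> group_algebra G"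

lemma group_algebra_bounded_ops:
  assumes "group G" "carrier G = UNIV"
  shows "group_algebra G \<subseteq> bounded_ops"
proof
  fix T assume "T \<in> group_algebra G"
  thus "T \<in> bounded_ops"
    using cstar_subalgebra_bounded_ops left_regular_bounded_ops[OF assms]
    by induction (auto simp: cstar_subalgebra_def)
qed

lemma group_algebra_add:
  assumes "S \<in> group_algebra G" "T \<in> group_algebra G"
  shows "S + T \<in> group_algebra G"
  using assms by induction (auto simp: add.assoc intro: group_algebra.intros)

lemma group_algebra_scale:
  assumes "T \<in> group_algebra G"
  shows "op_scale c T \<in> group_algebra G"
  using assms
proof induction
  case zero
  have "op_scale c 0 = (0 :: 'a ell2 \<Rightarrow>\<^sub>L 'a ell2)" by (auto intro!: blinfun_eqI ell2_eqI)
  thus ?case by (simp add: group_algebra.zero)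
next
  case (add_term T d g)
  have "op_scale c (op_scale d (left_regular G g) + T) = op_scale (c * d) (left_regular G g) + op_scale c T"
    by (auto intro!: blinfun_eqI ell2_eqI simp: blinfun.add_left algebra_simps)
  thus ?case using group_algebra.add_term[OF add_term.IH] by simp
qed

lemma group_algebra_mult:
  assumes G: "group G" "carrier G = UNIV"
    and S: "S \<in> group_algebra G" and T: "T \<in> group_algebra G"
  shows "S o\<^sub>L T \<in> group_algebra G"
  using S
proof induction
  case zero
  have "0 o\<^sub>L T = 0" by (auto intro!: blinfun_eqI)
  thus ?case by (simp add: group_algebra.zero)
next
  case (add_term S c g)
  \<comment> \<open>An inner induction on the right factor treats a single translation on the
    left.\<close>
  have "left_regular G g o\<^sub>L T \<in> group_algebra G"
    using T
  proof induction
    case zero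
    have "left_regular G g o\<^sub>L 0 = 0" by (auto intro!: blinfun_eqI)
    thus ?case by (simp add: group_algebra.zero)
  next
    case (add_term T d h)
    have "left_regular G g o\<^sub>L (op_scale d (left_regular G h) + T)
        = op_scale d (left_regular G g o\<^sub>L left_regular G h) + (left_regular G g o\<^sub>L T)"
      using left_regular_bounded_ops[OF G, of g]
      by (auto intro!: blinfun_eqI simp: blinfun.add_left blinfun.add_right bounded_ops_def)
    thus ?case
      using group_algebra.add_term[OF add_term.IH] by (simp add: left_regular_mult[OF G])
  qed
  from group_algebra_add[OF group_algebra_scale[OF this, of c] add_term.IH]
  show ?case
    by (rule back_subst[of "\<lambda>T. T \<in> group_algebra G"])
       (auto intro!: blinfun_eqI simp: blinfun.add_left)
qed

lemma group_algebra_adj: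
  assumes G: "group G" "carrier G = UNIV" and T: "T \<in> group_algebra G"
  shows "adj T \<in> group_algebra G"
  using T
proof induction
  case zero
  have "adj (0 :: 'a ell2 \<Rightarrow>\<^sub>L 'a ell2) = 0"
    by (rule adj_eqI) (simp add: cinner_def)
  thus ?case by (simp add: group_algebra.zero)
next
  case (add_term T c g)
  have "op_scale c (left_regular G g) \<in> bounded_ops" "T \<in> bounded_ops" "left_regular G g \<in> bounded_ops"
    using group_algebra_bounded_ops[OF G] add_term.hyps left_regular_bounded_ops[OF G, of g]
      cstar_subalgebra_bounded_ops by (auto simp: cstar_subalgebra_def)
  thus ?case
    using group_algebra.add_term[OF add_term.IH]
    by (simp add: adj_add adj_op_scale adj_left_regular[OF G])
qed

lemma cstar_subalgebra_closure:
  assumes sub: "D \<subseteq> bounded_ops" and zero: "0 \<in> D"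
    and add: "\<And>S T. S \<in> D \<Longrightarrow> T \<in> D \<Longrightarrow> S + T \<in> D"
    and scale: "\<And>c T. T \<in> D \<Longrightarrow> op_scale c T \<in> D"
    and mult: "\<And>S T. S \<in> D \<Longrightarrow> T \<in> D \<Longrightarrow> S o\<^sub>L T \<in> D"
    and adj: "\<And>T. T \<in> D \<Longrightarrow> adj T \<in> D"
  shows "cstar_subalgebra (closure D)"
  unfolding cstar_subalgebra_def
proof (intro conjI ballI allI)
  show cl: "closure D \<subseteq> bounded_ops"
    by (rule closure_minimal[OF sub closed_bounded_ops])
  show "0 \<in> closure D" using zero closure_subset by blast
  fix S T c assume S: "S \<in> closure D" and T: "T \<in> closure D"
  then obtain s t where s: "\<And>n. s n \<in> D" "s \<longlonglongrightarrow> S" and t: "\<And>n. t n \<in> D" "t \<longlonglongrightarrow> T"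
    unfolding closure_sequential by metis
  show "S + T \<in> closure D"
    unfolding closure_sequential using tendsto_add[OF s(2) t(2)] add s(1) t(1)
    by (intro exI[of _ "\<lambda>n. s n + t n"]) blast
  have "bounded_bilinear (o\<^sub>L)" by (rule bounded_bilinear_blinfun_compose)
  from bounded_bilinear.tendsto[OF this s(2) t(2)] show "S o\<^sub>L T \<in> closure D"
    unfolding closure_sequential using mult s(1) t(1)
    by (intro exI[of _ "\<lambda>n. s n o\<^sub>L t n"]) blast
next
  fix T c assume T: "T \<in> closure D"
  then obtain t where t: "\<And>n. t n \<in> D" "t \<longlonglongrightarrow> T"
    unfolding closure_sequential by metis
  have lim: "(\<lambda>n. norm (t n - T)) \<longlonglongrightarrow> 0"
    using t(2) by (simp add: LIM_zero tendsto_norm_zero)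
  have "norm (op_scale c (t n) - op_scale c T) = cmod c * norm (t n - T)" for n
  proof -
    have "op_scale c (t n) - op_scale c T = op_scale c (t n - T)"
      by (auto intro!: blinfun_eqI ell2_eqI simp: blinfun.diff_left right_diff_distrib)
    thus ?thesis by simp
  qed
  hence "(\<lambda>n. norm (op_scale c (t n) - op_scale c T)) \<longlonglongrightarrow> 0"
    using tendsto_mult_left[OF lim, of "cmod c"] by simp
  hence "(\<lambda>n. op_scale c (t n)) \<longlonglongrightarrow> op_scale c T"
    by (rule LIM_zero_cancel[OF tendsto_norm_zero_cancel])
  thus "op_scale c T \<in> closure D"
    unfolding closure_sequential using scale t(1)
    by (intro exI[of _ "\<lambda>n. op_scale c (t n)"]) blast
  have bT: "T \<in> bounded_ops" and bt: "t n \<in> bounded_ops" for n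
    using T t(1) sub closure_minimal[OF sub closed_bounded_ops] by blast+
  \<comment> \<open>Limits pass through \<open>adj\<close> because it is isometric. Both that fact
    and additivity are available only inside \<open>bounded_ops\<close>, hence the detour that
    writes the difference as a sum of members.\<close>
  have "norm (adj (t n) - adj T) = norm (t n - T)" for n
  proof -
    have "t n - T = t n + op_scale (-1) T" by (simp flip: minus_eq_op_scale)
    moreover have "op_scale (-1) T \<in> bounded_ops"
      using bT cstar_subalgebra_bounded_ops by (auto simp: cstar_subalgebra_def)
    moreover have "t n + op_scale (-1) T \<in> bounded_ops"
      using calculation(2) bt[of n] cstar_subalgebra_bounded_ops by (auto simp: cstar_subalgebra_def)
    moreover have "adj (t n + op_scale (-1) T) = adj (t n) + op_scale (-1) (adj T)"
      using calculation(2) bt[of n] bT by (simp add: adj_add adj_op_scale)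
    hence "adj (t n + op_scale (-1) T) = adj (t n) - adj T" by (simp flip: minus_eq_op_scale)
    ultimately show ?thesis by (metis norm_adj)
  qed
  hence "(\<lambda>n. norm (adj (t n) - adj T)) \<longlonglongrightarrow> 0" using lim by simp
  hence "(\<lambda>n. adj (t n)) \<longlonglongrightarrow> adj T"
    by (rule LIM_zero_cancel[OF tendsto_norm_zero_cancel])
  thus "adj T \<in> closure D"
    unfolding closure_sequential using adj t(1)
    by (intro exI[of _ "\<lambda>n. adj (t n)"]) blast
qed simp

text \<open>Density of the group algebra: its closure is one of the C*-subalgebras over which the
  hull is the intersection.\<close>

lemma reduced_cstar_subset_closure:
  assumes G: "group G" "carrier G = UNIV"
  shows "reduced_cstar G \<subseteq> closure (group_algebra G)"
  unfolding reduced_cstar_def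
proof (rule hull_minimal)
  show "left_regular G ` carrier G \<subseteq> closure (group_algebra G)"
  proof
    fix T assume "T \<in> left_regular G ` carrier G"
    then obtain g where T: "T = left_regular G g" by blast
    have "op_scale 1 T + 0 \<in> group_algebra G"
      unfolding T by (intro group_algebra.intros)
    moreover have "op_scale 1 T + 0 = T" by (auto intro!: blinfun_eqI ell2_eqI)
    ultimately show "T \<in> closure (group_algebra G)" using closure_subset by auto
  qed
  show "cstar_subalgebra (closure (group_algebra G))"
    by (intro cstar_subalgebra_closure group_algebra_bounded_ops group_algebra.zero
        group_algebra_add group_algebra_scale group_algebra_mult group_algebra_adj G)
qed

lemma canonical_trace_left_regular:
  assumes G: "group G" "carrier G = UNIV"
  shows "canonical_trace G (left_regular G g) = (if g = \<one>\<^bsub>G\<^esub> then 1 else 0)"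
proof -
  interpret group G by fact
  show ?thesis
    using r_one[of g]
    by (auto simp: canonical_trace_def left_regular_ket[OF G] cinner_ket_right ell2_apply_ket G(2))
qed

lemma canonical_trace_add: "canonical_trace G (S + T) = canonical_trace G S + canonical_trace G T"
  by (simp add: canonical_trace_def blinfun.add_left cinner_add_left)

lemma canonical_trace_scale: "canonical_trace G (op_scale c T) = c * canonical_trace G T"
  by (simp add: canonical_trace_def cinner_cscale_left)

lemma norm_ket [simp]: "norm (ket h) = 1"
proof -
  have "(norm (ket h))\<^sup>2 = 1"
    by (simp add: power2_norm_eq_inner inner_ell2_def cinner_ket_right ell2_apply_ket)
  thus ?thesis using norm_ge_zero[of "ket h"] by (simp add: power2_eq_1_iff)
qed

lemma canonical_trace_bound: "cmod (canonical_trace G T) \<le> norm T"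
  using cinner_Cauchy_Schwarz[of "blinfun_apply T (ket \<one>\<^bsub>G\<^esub>)" "ket \<one>\<^bsub>G\<^esub>"]
    norm_blinfun[of T "ket \<one>\<^bsub>G\<^esub>"]
  by (simp add: canonical_trace_def)

section \<open>Mixing\<close>

text \<open>
  If \<open>\<bar>\<phi>(\<lambda>(w n))\<bar> \<ge> \<epsilon>\<close> for infinitely many \<open>n\<close>, pick \<open>N\<close> of them at mutual distance at least
  \<open>d\<close> and rotate the phases: then \<open>N \<epsilon> \<le> \<bar>\<phi>(\<Sum> z\<^sub>n \<lambda>(w n))\<bar> \<le> 4 sqrt N\<close>, which fails for large \<open>N\<close>.
\<close>

lemma state_left_regular_tendsto_0:
  assumes G: "group G" "carrier G = UNIV" and \<phi>: "state_on (reduced_cstar G) \<phi>"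
    and d: "d > 0" "\<And>i j. i + d \<le> j \<Longrightarrow> A i \<inter> A j = {}"
    and w: "\<And>n h. h \<notin> A n \<Longrightarrow> w n \<otimes>\<^bsub>G\<^esub> h \<in> A n"
  shows "(\<lambda>n::nat. \<phi> (left_regular G (w n))) \<longlonglongrightarrow> 0"
proof (rule ccontr)
  let ?L = "left_regular G"
  assume "\<not> (\<lambda>n. \<phi> (?L (w n))) \<longlonglongrightarrow> 0"
  then obtain e where e: "e > 0" and inf: "\<And>m. \<exists>n\<ge>m. cmod (\<phi> (?L (w n))) \<ge> e"
    unfolding LIMSEQ_iff by (auto simp: not_less)
  define J where "J = {n. cmod (\<phi> (?L (w n))) \<ge> e}"
  have "infinite J"
    using inf unfolding infinite_nat_iff_unbounded_le J_def by blast
  \<comment> \<open>By pigeonhole infinitely many bad indices share a residue mod \<open>d\<close>;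
    distinct ones among them are then at least \<open>d\<close> apart.\<close>
  moreover have "finite ((\<lambda>n. n mod d) ` J)"
    by (rule finite_subset[of _ "{..<d}"]) (use d in auto)
  ultimately obtain r where r: "infinite {n \<in> J. n mod d = r mod d}"
    using pigeonhole_infinite[of J "\<lambda>n. n mod d"] by auto
  \<comment> \<open>Chosen to contradict N e <= 4 sqrt N, where 4 is the 2 of
    \<open>state_bound\<close> times the 2 of the ping-pong estimate.\<close>
  obtain N :: nat where N: "16 / e\<^sup>2 < N" using reals_Archimedean2 by blast
  obtain K where K: "finite K" "card K = N" "K \<subseteq> {n \<in> J. n mod d = r mod d}"
    using infinite_arbitrarily_large[OF r, of N] by blast
  have sep: "i + d \<le> j" if "i \<in> K" "j \<in> K" "i < j" for i j
  proof -
    have "j mod d = i mod d" using K(3) that by (metis (mono_tags, lifting) mem_Collect_eq subsetD)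
    hence "d dvd j - i" using that by (metis less_imp_le mod_eq_dvd_iff_nat)
    thus ?thesis using that dvd_imp_le[of d "j - i"] by linarith
  qed
  have disj: "disjoint_family_on A K"
    unfolding disjoint_family_on_def using sep d(2) by (metis Int_commute linorder_neqE_nat)
  define c where "c n = \<phi> (?L (w n))" for n
  define z where "z n = cnj (c n) / cmod (c n)" for n
  have z: "cmod (z n) \<le> 1" for n by (simp add: z_def norm_divide)
  have cz: "z n * c n = cmod (c n)" for n
    using complex_norm_square[of "c n"]
    by (cases "c n = 0") (auto simp: z_def field_simps power2_eq_square)
  have add: "\<And>S T. S \<in> reduced_cstar G \<Longrightarrow> T \<in> reduced_cstar G \<Longrightarrow> \<phi> (S + T) = \<phi> S + \<phi> T"
    and scale: "\<And>c T. T \<in> reduced_cstar G \<Longrightarrow> \<phi> (op_scale c T) = c * \<phi> T"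
    using \<phi> by (auto simp: state_on_def)
  have alg: "cstar_subalgebra (reduced_cstar G)"
    using unital_cstar_algebra_reduced_cstar[OF G] by (simp add: unital_cstar_algebra_def)
  have L: "op_scale c (?L g) \<in> reduced_cstar G" for c g
    using alg left_regular_in_reduced_cstar[OF G(2)] by (auto simp: cstar_subalgebra_def)
  have zero: "\<phi> 0 = 0" using add[of 0 0] alg by (simp add: cstar_subalgebra_def)
  \<comment> \<open>Membership is carried along because \<phi> is additive only on the
    algebra.\<close>
  have "(\<Sum>n\<in>F. op_scale (z n) (?L (w n))) \<in> reduced_cstar G \<and>
      \<phi> (\<Sum>n\<in>F. op_scale (z n) (?L (w n))) = (\<Sum>n\<in>F. z n * c n)" if "finite F" for F
    using that
  proof induction
    case empty
    thus ?case using alg zero by (simp add: cstar_subalgebra_def)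
  next
    case (insert n F)
    thus ?case using alg L[of "z n" "w n"]
      by (simp add: cstar_subalgebra_def add scale left_regular_in_reduced_cstar[OF G(2)] c_def)
  qed
  note S = this[OF K(1)]
  have "real N * e \<le> (\<Sum>n\<in>K. cmod (c n))"
    using sum_mono[of K "\<lambda>_. e" "\<lambda>n. cmod (c n)"] K by (auto simp: J_def c_def)
  also have "\<dots> = cmod (\<phi> (\<Sum>n\<in>K. op_scale (z n) (?L (w n))))"
    using S by (simp add: cz sum_nonneg flip: of_real_sum)
  also have "\<dots> \<le> 2 * norm (\<Sum>n\<in>K. op_scale (z n) (?L (w n)))"
    by (rule state_bound[OF unital_cstar_algebra_reduced_cstar[OF G] \<phi>]) (use S in blast)
  also have "\<dots> \<le> 2 * (2 * sqrt (card K))"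
    by (intro mult_left_mono norm_left_regular_ping_pong[OF G K(1) disj] w z) simp_all
  finally have "real N * e \<le> 4 * sqrt N" using K by simp
  hence "(real N * e)\<^sup>2 \<le> (4 * sqrt N)\<^sup>2" by (rule power_mono) (use e in simp)
  hence "real N * (real N * e\<^sup>2) \<le> real N * 16"
    by (simp add: power_mult_distrib) (simp add: power2_eq_square mult_ac)
  moreover have "real N > 0" using N e by (metis divide_pos_pos order.strict_trans zero_less_numeral zero_less_power)
  ultimately have "real N * e\<^sup>2 \<le> 16" by simp
  thus False using N e by (simp add: divide_less_eq mult.commute)
qed

lemma state_on_automorphism_power:
  assumes A: "unital_cstar_algebra A" and \<alpha>: "cstar_automorphism A \<alpha>" and \<phi>: "state_on A \<phi>"
    and one: "\<alpha> id_blinfun = id_blinfun"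
  shows "state_on A (\<lambda>x. \<phi> ((\<alpha> ^^ n) x))"
proof (induction n)
  case 0
  thus ?case using \<phi> by simp
next
  case (Suc n)
  have A': "\<And>S T. S \<in> A \<Longrightarrow> T \<in> A \<Longrightarrow> S + T \<in> A" "\<And>c T. T \<in> A \<Longrightarrow> op_scale c T \<in> A"
    "\<And>S T. S \<in> A \<Longrightarrow> T \<in> A \<Longrightarrow> S o\<^sub>L T \<in> A" "\<And>T. T \<in> A \<Longrightarrow> adj T \<in> A"
    using A by (auto simp: unital_cstar_algebra_def cstar_subalgebra_def)
  have \<alpha>': "\<And>T. T \<in> A \<Longrightarrow> \<alpha> T \<in> A" "\<And>S T. S \<in> A \<Longrightarrow> T \<in> A \<Longrightarrow> \<alpha> (S + T) = \<alpha> S + \<alpha> T"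
    "\<And>c T. T \<in> A \<Longrightarrow> \<alpha> (op_scale c T) = op_scale c (\<alpha> T)"
    "\<And>S T. S \<in> A \<Longrightarrow> T \<in> A \<Longrightarrow> \<alpha> (S o\<^sub>L T) = \<alpha> S o\<^sub>L \<alpha> T" "\<And>T. T \<in> A \<Longrightarrow> \<alpha> (adj T) = adj (\<alpha> T)"
    using \<alpha> by (auto simp: cstar_automorphism_def linear_map_on_def)
  show ?case
    \<comment> \<open>The power is unfolded with the new \<alpha> innermost, so the inductive state
      is evaluated at images under \<alpha>, which stay in the algebra.\<close>
    using Suc by (simp add: state_on_def funpow_Suc_right one A' \<alpha>' del: funpow.simps)
qed

text \<open>Reduces mixing, for any group, to decay on the orbits of nontrivial elements: the
  identity is fixed with value 1, linearity gives the span, and the bounds on states and trace give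
  the closure.\<close>

lemma reduced_cstar_mixing:
  assumes G: "group G" "carrier G = UNIV"
    and \<alpha>: "cstar_automorphism (reduced_cstar G) \<alpha>"
    and \<beta>: "\<And>g. \<alpha> (left_regular G g) = left_regular G (\<beta> g)" "\<beta> \<one>\<^bsub>G\<^esub> = \<one>\<^bsub>G\<^esub>"
    and \<phi>: "state_on (reduced_cstar G) \<phi>"
    and null: "\<And>g. g \<noteq> \<one>\<^bsub>G\<^esub> \<Longrightarrow> (\<lambda>n. \<phi> (left_regular G ((\<beta> ^^ n) g))) \<longlonglongrightarrow> 0"
    and x: "x \<in> reduced_cstar G"
  shows "(\<lambda>n. \<phi> ((\<alpha> ^^ n) x)) \<longlonglongrightarrow> canonical_trace G x"
proof -
  let ?A = "reduced_cstar G" and ?L = "left_regular G"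
  define \<psi> where "\<psi> n x = \<phi> ((\<alpha> ^^ n) x)" for n x
  note A = unital_cstar_algebra_reduced_cstar[OF G]
  have alg: "cstar_subalgebra ?A" using A by (simp add: unital_cstar_algebra_def)
  have "\<alpha> id_blinfun = id_blinfun"
    using \<beta>(1)[of "\<one>\<^bsub>G\<^esub>"] by (simp add: \<beta>(2) left_regular_one[OF G])
  from state_on_automorphism_power[OF A \<alpha> \<phi> this]
  have \<psi>: "state_on ?A (\<psi> n)" for n unfolding \<psi>_def .
  have add: "\<psi> n (S + T) = \<psi> n S + \<psi> n T" if "S \<in> ?A" "T \<in> ?A" for S T n
    using \<psi>[of n] that by (simp add: state_on_def)
  have scale: "\<psi> n (op_scale c T) = c * \<psi> n T" if "T \<in> ?A" for c T n
    using \<psi>[of n] that by (simp add: state_on_def)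
  have pow: "(\<alpha> ^^ n) (?L g) = ?L ((\<beta> ^^ n) g)" for n g
    by (induction n) (simp_all add: \<beta>)
  have fixed: "(\<beta> ^^ n) \<one>\<^bsub>G\<^esub> = \<one>\<^bsub>G\<^esub>" for n
    by (induction n) (simp_all add: \<beta>)
  have gen: "(\<lambda>n. \<psi> n (?L g)) \<longlonglongrightarrow> canonical_trace G (?L g)" for g
  proof (cases "g = \<one>\<^bsub>G\<^esub>")
    case True
    have "\<psi> n (?L \<one>\<^bsub>G\<^esub>) = \<phi> (?L \<one>\<^bsub>G\<^esub>)" for n by (simp only: \<psi>_def pow fixed)
    moreover have "\<phi> (?L \<one>\<^bsub>G\<^esub>) = 1" using \<phi> by (simp add: state_on_def left_regular_one[OF G])
    ultimately show ?thesis using True by (simp add: canonical_trace_left_regular[OF G])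
  qed (use null[of g] in \<open>simp add: \<psi>_def pow canonical_trace_left_regular[OF G]\<close>)
  have L: "?L g \<in> ?A" for g by (rule left_regular_in_reduced_cstar[OF G(2)])
  have span: "T \<in> ?A \<and> (\<lambda>n. \<psi> n T) \<longlonglongrightarrow> canonical_trace G T" if "T \<in> group_algebra G" for T
    using that
  proof induction
    case zero
    have "0 \<in> ?A" using alg by (simp add: cstar_subalgebra_def)
    moreover from this have "\<psi> n 0 = 0" for n using add[of 0 0 n] by simp
    ultimately show ?case by (simp add: canonical_trace_def)
  next
    case (add_term T c g)
    have "op_scale c (?L g) \<in> ?A" using alg L by (auto simp: cstar_subalgebra_def)
    moreover have "(\<lambda>n. c * \<psi> n (?L g) + \<psi> n T) \<longlonglongrightarrow> c * canonical_trace G (?L g) + canonical_trace G T"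
      by (intro tendsto_intros gen) (use add_term.IH in blast)
    ultimately show ?case
      using add_term.IH alg
      by (simp add: add scale L canonical_trace_add canonical_trace_scale cstar_subalgebra_def)
  qed
  have "(\<lambda>n. \<psi> n x) \<longlonglongrightarrow> canonical_trace G x"
  proof (rule LIMSEQ_I)
    fix e :: real assume e: "e > 0"
    have "x \<in> closure (group_algebra G)" using reduced_cstar_subset_closure[OF G] x by blast
    then obtain T where T: "T \<in> group_algebra G" "dist T x < e / 4"
      using e by (metis closure_approachable divide_pos_pos zero_less_numeral)
    obtain M where M: "\<And>n. n \<ge> M \<Longrightarrow> cmod (\<psi> n T - canonical_trace G T) < e / 4"
      using span[OF T(1)] LIMSEQ_D[of _ _ "e / 4"] e by (metis divide_pos_pos zero_less_numeral)
    define D where "D = x + op_scale (-1) T"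
    have D: "D \<in> ?A"
      unfolding D_def using alg x span[OF T(1)]
      by (auto simp: cstar_subalgebra_def)
    have "D = x - T" by (simp add: D_def flip: minus_eq_op_scale)
    hence nD: "norm D < e / 4" using T(2) by (simp add: dist_norm norm_minus_commute)
    have xD: "x = T + D" using \<open>D = x - T\<close> by simp
    have "cmod (\<psi> n x - canonical_trace G x) < e" if "n \<ge> M" for n
    proof -
      have "\<psi> n x - canonical_trace G x
          = (\<psi> n T - canonical_trace G T) + (\<psi> n D - canonical_trace G D)"
        unfolding xD using add[of T D n] span[OF T(1)] D by (simp add: canonical_trace_add)
      also have "cmod \<dots> \<le> cmod (\<psi> n T - canonical_trace G T) + (cmod (\<psi> n D) + cmod (canonical_trace G D))"
        by (intro order_trans[OF norm_triangle_ineq] add_left_mono norm_triangle_ineq4)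
      \<comment> \<open>The remainder \<open>D\<close> costs 2 norm D through the state and norm D
        through the trace, which explains the tolerance e / 4.\<close>
      also have "\<dots> < e / 4 + (2 * norm D + norm D)"
        by (intro add_less_le_mono add_mono M that state_bound[OF A \<psi> D] canonical_trace_bound)
      finally show ?thesis using nD by simp
    qed
    thus "\<exists>M. \<forall>n\<ge>M. norm (\<psi> n x - canonical_trace G x) < e" by blast
  qed
  thus ?thesis by (simp add: \<psi>_def)
qed

section \<open>The free shift\<close>

lemma letters_inv_gen: "letters (inv\<^bsub>free_group\<^esub> gen a) = [(a, False)]"
proof -
  interpret group "free_group :: 'a free_word monoid" by (rule group_free_group)
  have r: "reduced_word [(a, False)]" by (simp add: reduced_word_def)
  have "Abs_free_word [(a, False)] \<otimes>\<^bsub>free_group\<^esub> gen a = \<one>\<^bsub>free_group\<^esub>"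
    by (simp add: letters_inject[symmetric] letters_mult letters_one letters_gen
        letters_Abs[OF r] flip_def)
  hence "inv\<^bsub>free_group\<^esub> gen a = Abs_free_word [(a, False)]"
    by (intro inv_equality) simp_all
  thus ?thesis by (simp add: letters_Abs[OF r])
qed

text \<open>An injective relabelling of generators neither creates nor destroys cancellations, so it
  commutes with \<open>red_cons\<close>.\<close>

lemma letters_hom:
  assumes \<beta>: "\<beta> \<in> hom free_group free_group" "\<And>a. \<beta> (gen a) = gen (f a)" and f: "inj f"
  shows "letters (\<beta> u) = map (\<lambda>l. (f (fst l), snd l)) (letters u)"
proof -
  interpret group_hom free_group free_group \<beta>
    using \<beta> by (simp add: group_hom_def group_hom_axioms_def group_free_group)
  have cons: "map (\<lambda>l. (f (fst l), snd l)) (red_cons l w)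
      = red_cons (f (fst l), snd l) (map (\<lambda>l. (f (fst l), snd l)) w)"
    for l w
    using f by (cases w) (auto simp: flip_def prod_eq_iff inj_eq)
  show ?thesis
    by (induction u rule: free_group_induct)
       (simp_all add: letters_one letters_mult letters_gen letters_inv_gen cons \<beta>(2))
qed

text \<open>The first letter of \<open>v\<close> has an index absent from \<open>u\<close>, so
  nothing cancels at the junction; inside \<open>u\<close> reducedness prevents it.\<close>

lemma foldr_red_cons_append:
  assumes "reduced_word u" "v = [] \<or> fst (hd v) \<notin> fst ` set u"
  shows "foldr red_cons u v = u @ v"
  using assms
proof (induction u)
  case (Cons l u)
  hence IH: "foldr red_cons u v = u @ v" by (auto simp: reduced_Cons)
  show ?case
  proof (cases u)
    case Nil
    thus ?thesis using Cons.prems(2) by (cases v) (auto simp: flip_def)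
  next
    case (Cons m u')
    thus ?thesis using IH Cons.prems(1) by (simp add: reduced_Cons)
  qed
qed simp

theorem corollary3p3:
  fixes \<beta> :: "int free_word \<Rightarrow> int free_word"
    and \<alpha> :: "(int free_word ell2 \<Rightarrow>\<^sub>L int free_word ell2) \<Rightarrow> (int free_word ell2 \<Rightarrow>\<^sub>L int free_word ell2)"
  assumes "\<beta> \<in> iso free_group free_group"
    and "\<And>i. \<beta> (gen i) = gen (i + 1)"
    and "cstar_automorphism (reduced_cstar free_group) \<alpha>"
    and "\<And>g. \<alpha> (left_regular free_group g) = left_regular free_group (\<beta> g)"
  shows "E_mixing (reduced_cstar free_group) \<alpha>
           (\<lambda>x. op_scale (canonical_trace free_group x) id_blinfun) \<and>
         (\<forall>x \<in> reduced_cstar free_group. \<forall>\<phi>. state_on (reduced_cstar free_group) \<phi> \<longrightarrow>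
           (\<lambda>n. \<phi> ((\<alpha> ^^ n) x)) \<longlonglongrightarrow> canonical_trace free_group x)"
proof -
  let ?G = "free_group :: int free_word monoid"
  have G: "group ?G" "carrier ?G = UNIV" by (simp_all add: group_free_group)
  have hom: "\<beta> ^^ n \<in> hom ?G ?G" for n
  proof (induction n)
    case (Suc n)
    thus ?case using assms(1) hom_compose[of "\<beta> ^^ n" ?G ?G \<beta> ?G] by (simp add: iso_def comp_def)
  qed (simp add: hom_def)
  have "(\<beta> ^^ n) (gen i) = gen (i + int n)" for n i
    by (induction n) (simp_all add: assms(2) algebra_simps)
  note letters = letters_hom[OF hom this]
  have one: "\<beta> \<one>\<^bsub>?G\<^esub> = \<one>\<^bsub>?G\<^esub>"
    using hom_one[OF _ G(1) G(1), of \<beta>] assms(1) by (simp add: iso_def)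
  have mix: "(\<lambda>n. \<phi> ((\<alpha> ^^ n) x)) \<longlonglongrightarrow> canonical_trace ?G x"
    if x: "x \<in> reduced_cstar ?G" and \<phi>: "state_on (reduced_cstar ?G) \<phi>" for x \<phi>
  proof (rule reduced_cstar_mixing[OF G assms(3,4) one \<phi> _ x])
    fix g assume "g \<noteq> \<one>\<^bsub>?G\<^esub>"
    hence g: "letters g \<noteq> []" by (metis letters_inject letters_one)
    define I where "I = fst ` set (letters g)"
    have "finite I" by (simp add: I_def)
    \<comment> \<open>Only the index of the first letter is tested, not its sign, so a word outside
      \<open>B n\<close> cannot cancel against the shifted \<open>g\<close>. The empty word counts
      as outside.\<close>
    define B where "B n = {h. letters h \<noteq> [] \<and> fst (hd (letters h)) \<in> (\<lambda>i. i + int n) ` I}" for n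
    \<comment> \<open>One more than the spread of \<open>I\<close>: translates of \<open>I\<close>
      at least this far apart are disjoint.\<close>
    define d where "d = nat (Max I - Min I + 1)"
    show "(\<lambda>n. \<phi> (left_regular ?G ((\<beta> ^^ n) g))) \<longlonglongrightarrow> 0"
    proof (rule state_left_regular_tendsto_0[OF G \<phi>, of d B])
      have "I \<noteq> {}" using g by (simp add: I_def)
      hence "Min I \<le> Max I" using \<open>finite I\<close> by simp
      thus "d > 0" by (simp add: d_def)
      have bd: "Min I \<le> i" "i \<le> Max I" if "i \<in> I" for i
        using \<open>finite I\<close> that by simp_all
      show "B i \<inter> B j = {}" if "i + d \<le> j" for i j
      proof -
        have "a + int i \<noteq> b + int j" if "a \<in> I" "b \<in> I" for a b
          using bd[OF that(1)] bd[OF that(2)] \<open>i + d \<le> j\<close> by (simp add: d_def)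
        thus ?thesis by (fastforce simp: B_def)
      qed
      fix n h assume h: "h \<notin> B n"
      let ?u = "letters ((\<beta> ^^ n) g)"
      have u: "?u = map (\<lambda>l. (fst l + int n, snd l)) (letters g)"
        by (rule letters) (simp add: inj_def)
      hence "fst ` set ?u = (\<lambda>i. i + int n) ` I"
        by (simp add: I_def image_image)
      hence "letters ((\<beta> ^^ n) g \<otimes>\<^bsub>?G\<^esub> h) = ?u @ letters h"
        using h by (auto simp: letters_mult B_def intro!: foldr_red_cons_append)
      thus "(\<beta> ^^ n) g \<otimes>\<^bsub>?G\<^esub> h \<in> B n"
        using g u by (cases "letters g") (auto simp: B_def I_def)
    qed
  qed
  have A: "unital_cstar_algebra (reduced_cstar ?G)"
    by (rule unital_cstar_algebra_reduced_cstar[OF G])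
  have "linear_map_on (reduced_cstar ?G) (\<lambda>x. op_scale (canonical_trace ?G x) id_blinfun)"
    using A
    by (auto simp: linear_map_on_def unital_cstar_algebra_def cstar_subalgebra_def
        canonical_trace_add canonical_trace_scale blinfun.add_left distrib_right
        intro!: blinfun_eqI ell2_eqI)
  moreover have "(\<lambda>n. \<phi> ((\<alpha> ^^ n) x)) \<longlonglongrightarrow> \<phi> (op_scale (canonical_trace ?G x) id_blinfun)"
    if "x \<in> reduced_cstar ?G" and \<phi>: "state_on (reduced_cstar ?G) \<phi>" for \<phi> x
  proof -
    \<comment> \<open>Every state sends a scalar multiple of the unit to that scalar, so both forms
      of the limit agree.\<close>
    have "\<phi> (op_scale (canonical_trace ?G x) id_blinfun) = canonical_trace ?G x"
      using \<phi> A by (simp add: state_on_def unital_cstar_algebra_def)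
    thus ?thesis using mix[OF that] by simp
  qed
  ultimately show ?thesis
    unfolding E_mixing_def using A assms(3) mix by auto
qed

end
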